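(* There is a streaming algorithm for triangle counting in max-degree $d$ graphs of length-$L$ turnstile streams using $O\left(\frac{d^3L^2}{\varepsilon^2T^2}\log n\right)$ bits of space. That is, given parameters $n,d,L,T$ and $\varepsilon\in(0,1)$, there is a streaming algorithm using $O\left(\frac{d^3L^2}{\varepsilon^2T^2}\log n\right)$ bits which, for every length-$L$ strict turnstile stream whose final state is (the indicator vector of) a graph with maximum degree at most $d$ and at least $T$ triangles, outputs with probability at least $2/3$ an estimate of the number of triangles of the final graph that is correct to within a multiplicative factor $1\pm\varepsilon$.
   Context: The stream is a sequence of $L$ updates $\sigma_1,\dots,\sigma_L$, each of the form $(e,\Delta)$ with $e\in E(K_n)$ (an edge on the vertex set $[n]$) and $\Delta\in\mathbb{Z}$. The state at time $t$ is the vector $x^{(t)}\in\mathbb{Z}^{E(K_n)}$ whose coordinate $x^{(t)}_e$ is the sum of the values $\Delta$ over all updates to $e$ among $\sigma_1,\dots,\sigma_t$. Strict turnstile means $x^{(t)}_e\ge0$ for all $e$ and $t$. The intermediate states may be arbitrary multigraphs, with no degree bound; the integers occurring (update values and multiplicities) are of size $\mathrm{poly}(n)$, so that each is representable in $O(\log n)$ bits. The final state $x=x^{(L)}$ is in $\{0,1\}^{E(K_n)}$, and the final graph $G$ is the graph on $[n]$ with edge set $\{e:x_e=1\}$; it has maximum degree at most $d$. Formally, the data stream problem uses a known lower bound $T$ on the number of triangles: any output is acceptable when the input is not valid or when the number of triangles of the final graph is less than $T$; otherwise, the acceptable outputs are those in $[(1-\varepsilon)T_G,(1+\varepsilon)T_G]$,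 where $T_G$ is the number of triangles of $G$. A streaming algorithm may be randomized; its space is the number of bits needed to represent the states it reaches. The constant in $O(\cdot)$ is absolute (depending only on the polynomial bound on the integers). *)

theory Defs
  imports "HOL-Probability.Probability"
begin

definition complete_edges :: "nat \<Rightarrow> nat set set" where
  "complete_edges n = {e. e \<subseteq> {1..n} \<and> card e = 2}"

definition degree :: "nat set set \<Rightarrow> nat \<Rightarrow> nat" where
  "degree F v = card {e \<in> F. v \<in> e}"

definition triangles :: "nat set set \<Rightarrow> nat set set" where
  "triangles F = {S. card S = 3 \<and> (\<forall>e. e \<subseteq> S \<and> card e = 2 \<longrightarrow> e \<in> F)}"

type_synonym update = "nat set \<times> int"

text \<open>The state vector after a whole update sequence; the state at time \<open>t\<close> is obtained from
  the prefix \<open>take t \<sigma>\<close>.\<close>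

definition freq :: "update list \<Rightarrow> nat set \<Rightarrow> int" where
  "freq \<sigma> e = (\<Sum>(e', \<Delta>)\<leftarrow>\<sigma>. if e' = e then \<Delta> else 0)"

definition final_graph :: "nat \<Rightarrow> update list \<Rightarrow> nat set set" where
  "final_graph n \<sigma> = {e \<in> complete_edges n. freq \<sigma> e = 1}"

definition num_triangles :: "nat \<Rightarrow> update list \<Rightarrow> nat" where
  "num_triangles n \<sigma> = card (triangles (final_graph n \<sigma>))"

text \<open>The exponent \<open>c\<close> fixes the polynomial bound \<open>n ^ c\<close> on the update values and on the
  multiplicities; intermediate states are otherwise arbitrary multigraphs.\<close>

definition valid_stream :: "nat \<Rightarrow> nat \<Rightarrow> nat \<Rightarrow> nat \<Rightarrow> update list \<Rightarrow> bool" where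
  "valid_stream c n d L \<sigma> \<longleftrightarrow>
     length \<sigma> = L \<and>
     (\<forall>(e, \<Delta>) \<in> set \<sigma>. e \<in> complete_edges n \<and> \<bar>\<Delta>\<bar> \<le> int n ^ c) \<and>
     (\<forall>t \<le> L. \<forall>e \<in> complete_edges n.
        0 \<le> freq (take t \<sigma>) e \<and> freq (take t \<sigma>) e \<le> int n ^ c) \<and>
     (\<forall>e \<in> complete_edges n. freq \<sigma> e \<in> {0, 1}) \<and>
     (\<forall>v \<in> {1..n}. degree (final_graph n \<sigma>) v \<le> d)"

text \<open>States are bit strings. All information carried from one update to the next, including
  any random seed or clock, has to be part of the state; fresh random bits may be drawn in each
  step.\<close>

record streaming_algorithm =
  init :: "bool list pmf"
  step :: "update \<Rightarrow> bool list \<Rightarrow> bool list pmf"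
  estimate :: "bool list \<Rightarrow> real pmf"

definition run :: "streaming_algorithm \<Rightarrow> update list \<Rightarrow> bool list pmf" where
  "run A \<sigma> = fold (\<lambda>u p. bind_pmf p (step A u)) \<sigma> (init A)"

definition result :: "streaming_algorithm \<Rightarrow> update list \<Rightarrow> real pmf" where
  "result A \<sigma> = bind_pmf (run A \<sigma>) (estimate A)"

text \<open>The space bound is worst case: over every state reached with positive probability on any
  sequence of updates to edges of \<open>K\<^sub>n\<close>, valid or not. Prefixes of a stream are again such
  sequences, so intermediate states are covered.\<close>

definition uses_space :: "streaming_algorithm \<Rightarrow> nat \<Rightarrow> real \<Rightarrow> bool" where
  "uses_space A n s \<longleftrightarrow>
     (\<forall>\<sigma>. fst ` set \<sigma> \<subseteq> complete_edges n \<longrightarrow>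
        (\<forall>b \<in> set_pmf (run A \<sigma>). real (length b) \<le> s))"

text \<open>Nothing is required on streams that are not valid or whose final graph has fewer than
  \<open>T\<close> triangles.\<close>

definition counts_triangles ::
  "streaming_algorithm \<Rightarrow> nat \<Rightarrow> nat \<Rightarrow> nat \<Rightarrow> nat \<Rightarrow> nat \<Rightarrow> real \<Rightarrow> bool" where
  "counts_triangles A c n d L T \<epsilon> \<longleftrightarrow>
     (\<forall>\<sigma>. valid_stream c n d L \<sigma> \<longrightarrow> T \<le> num_triangles n \<sigma> \<longrightarrow>
        measure_pmf.prob (result A \<sigma>)
          {(1 - \<epsilon>) * real (num_triangles n \<sigma>) .. (1 + \<epsilon>) * real (num_triangles n \<sigma>)} \<ge> 2 / 3)"

end

theory Submission
  imports Defs
begin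

text \<open>Call the \<open>birth\<close> of a final edge the last update at which its multiplicity leaves 0 for
  good. A sampler picks a uniformly random update, to an edge \<open>e\<close> say, and then, by reservoir
  sampling, one uniformly random \<open>f\<close> among the \<open>r\<close> later updates to edges that meet \<open>e\<close> in one
  vertex. Three counters decide whether these two updates are births and whether the edge closing
  the triangle is born still later. Every triangle of the final graph is thus found with
  probability exactly \<open>1 / (L r)\<close>, so the value \<open>L r\<close>, given when a triangle is found, has the
  number of triangles as its mean. A vertex lies in at most \<open>d\<^sup>2\<close> triangles and the updates
  have \<open>2 L\<close> endpoints in total, so the sum of \<open>r\<close> over all triangles is at most \<open>2 L d\<^sup>2\<close> and
  the second moment is at most \<open>2 L\<^sup>2 d\<^sup>2\<close>. By Chebyshev's inequality the average of
  \<open>O(d\<^sup>2 L\<^sup>2 / (\<epsilon> T)\<^sup>2)\<close> independent samplers is accurate enough. Each of them needs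
  \<open>O(log n + log L)\<close> bits, which is \<open>O(log n)\<close> if \<open>L < n\<^sup>3\<close>; for longer streams the space bound
  allows the whole state vector to be stored.\<close>

section \<open>Algorithms on abstract states\<close>

text \<open>The fold of \<open>run\<close> over an arbitrary state type, so that correctness can be
  argued on structured states and bit strings enter only once.\<close>

definition process :: "('u \<Rightarrow> 'a \<Rightarrow> 'a pmf) \<Rightarrow> 'a pmf \<Rightarrow> 'u list \<Rightarrow> 'a pmf" where
  "process stp p \<sigma> = fold (\<lambda>u p. bind_pmf p (stp u)) \<sigma> p"

lemma process_Nil [simp]: "process stp p [] = p"
  and process_Cons [simp]: "process stp p (u # \<sigma>) = process stp (bind_pmf p (stp u)) \<sigma>"
  and process_snoc [simp]: "process stp p (\<sigma> @ [u]) = bind_pmf (process stp p \<sigma>) (stp u)"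
  by (simp_all add: process_def)

lemma process_bind_pmf: "process stp (bind_pmf p f) \<sigma> = bind_pmf p (\<lambda>x. process stp (f x) \<sigma>)"
  by (induction \<sigma> rule: rev_induct) (simp_all add: bind_assoc_pmf)

text \<open>The invariant is indexed by the number of updates read because the range of the counters
  grows with it.\<close>

lemma process_subset:
  assumes "set_pmf p \<subseteq> I 0"
    and "\<And>i u x. \<lbrakk>u \<in> set \<sigma>; i < length \<sigma>; x \<in> I i\<rbrakk> \<Longrightarrow> set_pmf (stp u x) \<subseteq> I (Suc i)"
  shows "set_pmf (process stp p \<sigma>) \<subseteq> I (length \<sigma>)"
  using assms by (induction \<sigma> rule: rev_induct) (simp, force)

text \<open>Arguments outside \<open>S\<close> also get codes of length \<open>m\<close>: the space
  bound covers invalid streams too, on which a process may leave \<open>S\<close>.\<close>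

lemma ex_fixed_length_code:
  assumes "finite S" "card S \<le> 2 ^ m"
  obtains enc :: "'a \<Rightarrow> bool list" where "inj_on enc S" "\<And>x. length (enc x) = m"
proof -
  let ?B = "{xs :: bool list. set xs \<subseteq> UNIV \<and> length xs = m}"
  have "card ?B = 2 ^ m" using card_lists_length_eq[of "UNIV :: bool set" m] by simp
  moreover have "finite ?B" by (rule finite_lists_length_eq) simp
  ultimately obtain f where f: "inj_on f S" "f ` S \<subseteq> ?B"
    using assms by (metis card_le_inj)
  show thesis
  proof (rule that[of "\<lambda>x. if x \<in> S then f x else replicate m False"])
    show "inj_on (\<lambda>x. if x \<in> S then f x else replicate m False) S"
      using f(1) by (simp add: inj_on_def)
  qed (use f(2) in auto)
qed

text \<open>The algorithm decodes, performs an abstract step and encodes again. Its space bound is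
  unconditional; the simulation is faithful along streams on which all reachable states stay in
  \<open>S\<close>, where decoding inverts encoding.\<close>

lemma ex_bit_algorithm:
  fixes p :: "'a pmf" and stp :: "update \<Rightarrow> 'a \<Rightarrow> 'a pmf"
  assumes "finite S" "card S \<le> 2 ^ m"
  shows "\<exists>A. uses_space A n (real m) \<and>
    (\<forall>\<sigma>. (\<forall>i. set_pmf (process stp p (take i \<sigma>)) \<subseteq> S) \<longrightarrow>
       result A \<sigma> = map_pmf est (process stp p \<sigma>))"
proof -
  obtain enc :: "'a \<Rightarrow> bool list" where inj: "inj_on enc S" and len: "\<And>x. length (enc x) = m"
    using ex_fixed_length_code[OF assms] by blast
  define A where "A = \<lparr>init = map_pmf enc p,
    step = (\<lambda>u b. map_pmf enc (stp u (inv_into S enc b))),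
    estimate = (\<lambda>b. return_pmf (est (inv_into S enc b)))\<rparr>"
  have run_snoc: "run A (\<sigma> @ [u]) = bind_pmf (run A \<sigma>) (step A u)" for \<sigma> u
    by (simp add: run_def)
  have "length b = m" if "b \<in> set_pmf (run A \<sigma>)" for b \<sigma>
    using that
    by (cases \<sigma> rule: rev_cases) (auto simp: run_def A_def len)
  then have space: "uses_space A n (real m)"
    by (simp add: uses_space_def)
  have run: "run A \<sigma> = map_pmf enc (process stp p \<sigma>)"
    if "\<And>i. set_pmf (process stp p (take i \<sigma>)) \<subseteq> S" for \<sigma>
    using that
  proof (induction \<sigma> rule: rev_induct)
    case Nil
    then show ?case by (simp add: run_def A_def)
  next
    case (snoc u \<sigma>)
    have *: "set_pmf (process stp p (take i \<sigma>)) \<subseteq> S" for i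
      using snoc.prems[of "min i (length \<sigma>)"] by (simp add: min_def split: if_splits)
    have "run A (\<sigma> @ [u]) =
        bind_pmf (process stp p \<sigma>) (\<lambda>x. map_pmf enc (stp u (inv_into S enc (enc x))))"
      by (simp add: run_snoc snoc.IH[OF *] bind_map_pmf) (simp add: A_def)
    also have "\<dots> = bind_pmf (process stp p \<sigma>) (\<lambda>x. map_pmf enc (stp u x))"
      using *[of "length \<sigma>"] by (intro bind_pmf_cong) (auto simp: inj inv_into_f_f)
    finally show ?case by (simp add: map_bind_pmf)
  qed
  have "result A \<sigma> = map_pmf est (process stp p \<sigma>)"
    if S: "\<And>i. set_pmf (process stp p (take i \<sigma>)) \<subseteq> S" for \<sigma>
  proof -
    have "result A \<sigma> = bind_pmf (process stp p \<sigma>) (\<lambda>x. return_pmf (est (inv_into S enc (enc x))))"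
      by (simp add: result_def run[OF S] bind_map_pmf) (simp add: A_def)
    also have "\<dots> = bind_pmf (process stp p \<sigma>) (\<lambda>x. return_pmf (est x))"
      using S[of "length \<sigma>"] by (intro bind_pmf_cong) (auto simp: inj inv_into_f_f)
    finally show ?thesis by (simp add: map_pmf_def)
  qed
  with space show ?thesis by blast
qed

lemma uses_space_mono: "uses_space A n s \<Longrightarrow> s \<le> s' \<Longrightarrow> uses_space A n s'"
  unfolding uses_space_def by (meson order_trans)

section \<open>Independent copies and Chebyshev's inequality\<close>

text \<open>Every copy draws its own coins, so a step preserves product distributions and samplers
  reading the same stream stay independent.\<close>

lemma process_Pi_pmf:
  assumes "finite I"
  shows "process (\<lambda>u f. Pi_pmf I x0 (\<lambda>i. stp u (f i))) (Pi_pmf I x0 (\<lambda>_. p)) \<sigma> =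
    Pi_pmf I x0 (\<lambda>_. process stp p \<sigma>)"
proof (induction \<sigma> rule: rev_induct)
  case (snoc u \<sigma>)
  then show ?case
    using Pi_pmf_bind[OF assms, of x0 "\<lambda>_. process stp p \<sigma>" "\<lambda>_. stp u" x0] by simp
qed simp

lemma expectation_pair_pmf:
  fixes f :: "'a \<times> 'b \<Rightarrow> real"
  assumes "finite (set_pmf p)" "finite (set_pmf q)"
  shows "measure_pmf.expectation (pair_pmf p q) f =
    measure_pmf.expectation p (\<lambda>x. measure_pmf.expectation q (\<lambda>y. f (x, y)))"
proof -
  have "measure_pmf.expectation (pair_pmf p q) f =
      (\<Sum>z\<in>set_pmf p \<times> set_pmf q. pmf (pair_pmf p q) z * f z)"
    using assms by (subst integral_measure_pmf[where A = "set_pmf p \<times> set_pmf q"]) auto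
  also have "\<dots> = (\<Sum>x\<in>set_pmf p. \<Sum>y\<in>set_pmf q. pmf p x * pmf q y * f (x, y))"
    by (auto simp: sum.cartesian_product pmf_pair intro!: sum.cong)
  also have "\<dots> = measure_pmf.expectation p (\<lambda>x. measure_pmf.expectation q (\<lambda>y. f (x, y)))"
    using assms
    by (simp add: integral_measure_pmf[where A = "set_pmf p"] integral_measure_pmf[where A = "set_pmf q"]
        sum_distrib_left mult.assoc)
  finally show ?thesis .
qed

text \<open>Expanding the square along the newly inserted coordinate leaves a cross term that
  vanishes because \<open>g\<close> has mean 0.\<close>

lemma second_moment_sum_Pi_pmf:
  fixes g :: "'a \<Rightarrow> real"
  assumes "finite I" and fin: "finite (set_pmf p)" and mean: "measure_pmf.expectation p g = 0"
  shows "measure_pmf.expectation (Pi_pmf I x0 (\<lambda>_. p)) (\<lambda>f. (\<Sum>i\<in>I. g (f i))\<^sup>2) =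
    real (card I) * measure_pmf.expectation p (\<lambda>x. (g x)\<^sup>2)"
  using \<open>finite I\<close>
proof (induction I rule: finite_induct)
  case (insert j I)
  let ?Q = "Pi_pmf I x0 (\<lambda>_. p)"
  have finQ: "finite (set_pmf ?Q)"
    using insert.hyps fin by (auto simp: set_Pi_pmf)
  have int: "integrable (measure_pmf p) h" "integrable (measure_pmf ?Q) h'"
    for h :: "'a \<Rightarrow> real" and h' :: "(_ \<Rightarrow> 'a) \<Rightarrow> real"
    using fin finQ by (auto intro: integrable_measure_pmf_finite)
  have upd: "(\<Sum>i\<in>I. g (if i = j then y else f i)) = (\<Sum>i\<in>I. g (f i))" for f y
    using insert.hyps by (intro sum.cong) auto
  have "measure_pmf.expectation (Pi_pmf (insert j I) x0 (\<lambda>_. p)) (\<lambda>f. (\<Sum>i\<in>insert j I. g (f i))\<^sup>2)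
     = measure_pmf.expectation p (\<lambda>y. measure_pmf.expectation ?Q (\<lambda>f. (g y + (\<Sum>i\<in>I. g (f i)))\<^sup>2))"
    using insert.hyps fin finQ
    by (simp add: Pi_pmf_insert expectation_pair_pmf upd case_prod_unfold)
  also have "\<dots> = measure_pmf.expectation p (\<lambda>y. (g y)\<^sup>2 +
      2 * g y * measure_pmf.expectation ?Q (\<lambda>f. \<Sum>i\<in>I. g (f i)) +
      measure_pmf.expectation ?Q (\<lambda>f. (\<Sum>i\<in>I. g (f i))\<^sup>2))"
    by (simp add: power2_sum int)
  also have "\<dots> = measure_pmf.expectation p (\<lambda>y. (g y)\<^sup>2) +
      measure_pmf.expectation ?Q (\<lambda>f. (\<Sum>i\<in>I. g (f i))\<^sup>2)"
    by (simp add: int mean)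
  finally show ?case
    using insert by (simp add: algebra_simps)
qed simp

text \<open>Centring at the mean only lowers the second moment, and variances of independent copies
  add, so Chebyshev's inequality applies to the centred sum with threshold
  \<open>real k * a\<close>.\<close>

lemma Pi_pmf_average_concentration:
  fixes h :: "'a \<Rightarrow> real"
  assumes fin: "finite (set_pmf p)" and k: "k > 0" and a: "a > 0"
    and mean: "measure_pmf.expectation p h = \<mu>"
    and moment: "measure_pmf.expectation p (\<lambda>x. (h x)\<^sup>2) \<le> B"
  shows "measure_pmf.prob (map_pmf (\<lambda>f. (\<Sum>i<k. h (f i)) / real k) (Pi_pmf {..<k} x0 (\<lambda>_. p)))
      {\<mu> - a .. \<mu> + a} \<ge> 1 - B / (real k * a\<^sup>2)"
proof -
  let ?P = "Pi_pmf {..<k} x0 (\<lambda>_. p)"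
  let ?S = "\<lambda>f. \<Sum>i<k. (h (f i) - \<mu>)"
  have finP: "finite (set_pmf ?P)"
    using fin by (auto simp: set_Pi_pmf)
  have int: "integrable (measure_pmf p) h" "integrable (measure_pmf ?P) h'"
    for h :: "'a \<Rightarrow> real" and h' :: "(_ \<Rightarrow> 'a) \<Rightarrow> real"
    using fin finP by (auto intro: integrable_measure_pmf_finite)
  have "measure_pmf.expectation p (\<lambda>x. (h x - \<mu>)\<^sup>2) = measure_pmf.expectation p (\<lambda>x. (h x)\<^sup>2) - \<mu>\<^sup>2"
    using measure_pmf.variance_eq[of p h] by (simp add: int mean)
  also have "\<dots> \<le> B"
    using moment by (smt (verit) zero_le_power2)
  finally have var: "measure_pmf.expectation p (\<lambda>x. (h x - \<mu>)\<^sup>2) \<le> B" .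
  have ka: "real k * a > 0" using k a by simp
  have "measure_pmf.prob ?P {f. \<bar>?S f\<bar> \<ge> real k * a}
      \<le> measure_pmf.expectation ?P (\<lambda>f. (?S f)\<^sup>2) / (real k * a)\<^sup>2"
    using measure_pmf.second_moment_method[where M = ?P and f = ?S and a = "real k * a"] ka int
    by simp
  also have "\<dots> = real k * measure_pmf.expectation p (\<lambda>x. (h x - \<mu>)\<^sup>2) / (real k * a)\<^sup>2"
    using fin by (subst second_moment_sum_Pi_pmf) (simp_all add: int mean)
  also have "\<dots> \<le> real k * B / (real k * a)\<^sup>2"
    by (intro divide_right_mono mult_left_mono var) auto
  also have "\<dots> = B / (real k * a\<^sup>2)"
    using k a by (simp add: power2_eq_square)
  finally have tail: "measure_pmf.prob ?P {f. \<bar>?S f\<bar> \<ge> real k * a} \<le> B / (real k * a\<^sup>2)" .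
  have "(\<Sum>i<k. h (f i)) / real k \<in> {\<mu> - a .. \<mu> + a}" if "\<not> \<bar>?S f\<bar> \<ge> real k * a" for f
  proof -
    have "?S f = real k * ((\<Sum>i<k. h (f i)) / real k - \<mu>)"
      using k by (simp add: sum_subtractf field_simps)
    with that k have "\<bar>(\<Sum>i<k. h (f i)) / real k - \<mu>\<bar> < a"
      by (simp add: abs_mult)
    then show ?thesis by (simp add: abs_less_iff)
  qed
  then have "UNIV - {f. \<bar>?S f\<bar> \<ge> real k * a} \<subseteq> (\<lambda>f. (\<Sum>i<k. h (f i)) / real k) -` {\<mu> - a .. \<mu> + a}"
    by blast
  then have "measure_pmf.prob ?P (UNIV - {f. \<bar>?S f\<bar> \<ge> real k * a})
      \<le> measure_pmf.prob ?P ((\<lambda>f. (\<Sum>i<k. h (f i)) / real k) -` {\<mu> - a .. \<mu> + a})"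
    by (intro measure_pmf.finite_measure_mono) auto
  moreover have "measure_pmf.prob ?P (UNIV - {f. \<bar>?S f\<bar> \<ge> real k * a}) =
      1 - measure_pmf.prob ?P {f. \<bar>?S f\<bar> \<ge> real k * a}"
    using measure_pmf.prob_compl[of "{f. \<bar>?S f\<bar> \<ge> real k * a}" ?P] by simp
  ultimately show ?thesis
    using tail by (simp add: measure_map_pmf)
qed

section \<open>The triangle sampler\<close>

text \<open>A sampler in state \<open>Wait j\<close> ignores \<open>j\<close> more updates and then picks the next one. In state
  \<open>Track e y r q\<close> it follows the picked edge \<open>e\<close> with counter \<open>y\<close>, has since seen \<open>r\<close> updates to
  edges meeting \<open>e\<close> in one vertex, and holds in \<open>q\<close> one of these, chosen uniformly, as a triple of
  its edge \<open>f\<close>, the counter of \<open>f\<close>, and the counter of the third edge of the triangle on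
  \<open>e \<union> f\<close>.\<close>

datatype sampler = Wait nat | Track "nat set" int nat "(nat set \<times> int \<times> int) option"

text \<open>The value 0 is absorbing: once the multiplicity has fallen back to its value before the
  picked update, that update is not a birth, whatever follows.\<close>

definition sticky :: "int \<Rightarrow> int \<Rightarrow> int" where
  "sticky y \<Delta> = (if y \<le> 0 then 0 else max 0 (y + \<Delta>))"

text \<open>Lindley's recursion: started at 0, the counter holds the present multiplicity minus its
  minimum since the start. It recovers from a fall, since the closing edge may be born at any later
  update.\<close>

definition reflected :: "int \<Rightarrow> int \<Rightarrow> int" where
  "reflected y \<Delta> = max 0 (y + \<Delta>)"

definition on_edge :: "(int \<Rightarrow> int \<Rightarrow> int) \<Rightarrow> nat set \<Rightarrow> update \<Rightarrow> int \<Rightarrow> int" where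
  "on_edge g e u y = (if fst u = e then g y (snd u) else y)"

text \<open>For two edges with one common vertex the symmetric difference is the third side of their
  triangle.\<close>

definition closing :: "nat set \<Rightarrow> nat set \<Rightarrow> nat set" where
  "closing e f = (e - f) \<union> (f - e)"

text \<open>On two-element sets this says that exactly one vertex is shared.\<close>

definition incident :: "nat set \<Rightarrow> nat set \<Rightarrow> bool" where
  "incident e f \<longleftrightarrow> f \<noteq> e \<and> e \<inter> f \<noteq> {}"

fun follow :: "nat set \<Rightarrow> update \<Rightarrow> nat set \<times> int \<times> int \<Rightarrow> nat set \<times> int \<times> int" where
  "follow e u (f, a, b) = (f, on_edge sticky f u a, on_edge reflected (closing e f) u b)"

text \<open>The incident update with number \<open>Suc r\<close> replaces the held one with
  probability 1 / (r + 1). A fresh sticky counter starts at the positive part of the update value,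
  so an update that is not positive is rejected from the outset. The counter of the closing edge
  starts at 0 because it measures only what follows.\<close>

fun sampler_step :: "update \<Rightarrow> sampler \<Rightarrow> sampler pmf" where
  "sampler_step u (Wait j) =
     return_pmf (if j = 0 then Track (fst u) (max 0 (snd u)) 0 None else Wait (j - 1))"
| "sampler_step u (Track e y r q) =
     (if incident e (fst u)
      then map_pmf (\<lambda>b. Track e (on_edge sticky e u y) (Suc r)
             (if b then Some (fst u, max 0 (snd u), 0) else map_option (follow e u) q))
           (bernoulli_pmf (1 / real (Suc r)))
      else return_pmf (Track e (on_edge sticky e u y) r (map_option (follow e u) q)))"

definition sampler_init :: "nat \<Rightarrow> sampler pmf" where
  "sampler_init L = map_pmf Wait (pmf_of_set {..<L})"

fun sampler_value :: "nat \<Rightarrow> sampler \<Rightarrow> real" where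
  "sampler_value L (Track e y r (Some (f, a, b))) =
     (if y = 1 \<and> a = 1 \<and> b = 1 then real L * real r else 0)"
| "sampler_value L _ = 0"

section \<open>Reservoir sampling and the law of one sampler\<close>

definition uniform_option :: "'a set \<Rightarrow> 'a option pmf" where
  "uniform_option A = (if A = {} then return_pmf None else map_pmf Some (pmf_of_set A))"

text \<open>With a = \<open>card A\<close>, the new element is taken with probability 1/(a + 1), and
  an old one is held with probability a/(a + 1) * 1/a, the same value.\<close>

lemma uniform_option_insert:
  assumes "finite A" "x \<notin> A"
  shows "uniform_option (insert x A) = bind_pmf (bernoulli_pmf (1 / real (Suc (card A))))
    (\<lambda>b. if b then return_pmf (Some x) else uniform_option A)"
proof (cases "A = {}")
  case True
  have "bernoulli_pmf 1 = return_pmf True"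
  proof (rule pmf_eqI)
    show "pmf (bernoulli_pmf 1) b = pmf (return_pmf True) b" for b
      by (cases b) simp_all
  qed
  then show ?thesis
    using True by (simp add: uniform_option_def pmf_of_set_singleton bind_return_pmf)
next
  case False
  have "pmf_of_set (insert x A) = bind_pmf (bernoulli_pmf (1 / real (Suc (card A))))
      (\<lambda>b. if b then return_pmf x else pmf_of_set A)"
  proof (rule pmf_eqI)
    fix i
    have "card A > 0" using assms False by (simp add: card_gt_0_iff)
    then show "pmf (pmf_of_set (insert x A)) i = pmf (bind_pmf (bernoulli_pmf (1 / real (Suc (card A))))
      (\<lambda>b. if b then return_pmf x else pmf_of_set A)) i"
      using assms False
      by (auto simp: pmf_bind pmf_return indicator_def field_simps)
        (smt (verit) mult_nonneg_nonneg of_nat_0_le_iff)+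
  qed
  then show ?thesis
    using False by (simp add: uniform_option_def map_bind_pmf if_distrib cong: if_cong)
qed

lemma expectation_uniform_option:
  fixes g :: "'a option \<Rightarrow> real"
  assumes "finite A"
  shows "measure_pmf.expectation (uniform_option A) g =
    (if A = {} then g None else (\<Sum>x\<in>A. g (Some x)) / real (card A))"
  using assms by (simp add: uniform_option_def integral_pmf_of_set)

definition count_from :: "(int \<Rightarrow> int \<Rightarrow> int) \<Rightarrow> nat set \<Rightarrow> int \<Rightarrow> update list \<Rightarrow> int" where
  "count_from g e y \<tau> = fold (on_edge g e) \<tau> y"

text \<open>Positions are relative to \<open>\<tau>\<close>, the part of the stream after the picked
  update; if that update has position \<open>t\<close>, then \<open>s\<close> stands for
  \<open>Suc t + s\<close> in the whole stream.\<close>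

definition incidences :: "nat set \<Rightarrow> update list \<Rightarrow> nat set" where
  "incidences e \<tau> = {s. s < length \<tau> \<and> incident e (fst (\<tau> ! s))}"

definition second_edge :: "nat set \<Rightarrow> update list \<Rightarrow> nat \<Rightarrow> nat set \<times> int \<times> int" where
  "second_edge e \<tau> s = (let f = fst (\<tau> ! s); \<rho> = drop (Suc s) \<tau> in
     (f, count_from sticky f (max 0 (snd (\<tau> ! s))) \<rho>, count_from reflected (closing e f) 0 \<rho>))"

lemma finite_incidences [simp]: "finite (incidences e \<tau>)"
  by (simp add: incidences_def)

lemma count_from_snoc: "count_from g e y (\<tau> @ [u]) = on_edge g e u (count_from g e y \<tau>)"
  by (simp add: count_from_def)

lemma second_edge_snoc:
  "s < length \<tau> \<Longrightarrow> second_edge e (\<tau> @ [u]) s = follow e u (second_edge e \<tau> s)"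
  "second_edge e (\<tau> @ [u]) (length \<tau>) = (fst u, max 0 (snd u), 0)"
  by (simp_all add: second_edge_def Let_def nth_append count_from_snoc) (simp add: count_from_def)

lemma incidences_snoc:
  "incidences e (\<tau> @ [u]) =
    (if incident e (fst u) then insert (length \<tau>) (incidences e \<tau>) else incidences e \<tau>)"
  by (auto simp: incidences_def nth_append less_Suc_eq)

lemma set_uniform_option: "finite A \<Longrightarrow> Some s \<in> set_pmf (uniform_option A) \<Longrightarrow> s \<in> A"
  by (auto simp: uniform_option_def split: if_splits)

text \<open>Following a held triple is deterministic, so the triple can be replaced by the index of
  its update. The only random quantity is this index, which evolves by reservoir sampling.\<close>

lemma process_Track:
  "process sampler_step (return_pmf (Track e y 0 None)) \<tau> =
    map_pmf (\<lambda>q. Track e (count_from sticky e y \<tau>) (card (incidences e \<tau>)) (map_option (second_edge e \<tau>) q))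
      (uniform_option (incidences e \<tau>))"
proof (induction \<tau> rule: rev_induct)
  case Nil
  then show ?case
    by (simp add: count_from_def incidences_def uniform_option_def)
next
  case (snoc u \<tau>)
  let ?I = "incidences e \<tau>"
  have nI: "length \<tau> \<notin> ?I" by (simp add: incidences_def)
  have second: "map_option (second_edge e (\<tau> @ [u])) q = map_option (follow e u) (map_option (second_edge e \<tau>) q)"
    if "q \<in> set_pmf (uniform_option ?I)" for q
  proof (cases q)
    case (Some s)
    with that have "s < length \<tau>"
      using set_uniform_option[OF finite_incidences, of s e \<tau>] by (simp add: incidences_def)
    with Some show ?thesis by (simp add: second_edge_snoc)
  qed simp
  show ?case
  proof (cases "incident e (fst u)")
    case False
    then show ?thesis
      by (auto simp: snoc map_pmf_def[symmetric] bind_map_pmf incidences_snoc count_from_snoc second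
          intro!: map_pmf_cong)
  next
    case True
    let ?y = "count_from sticky e y (\<tau> @ [u])" and ?r = "Suc (card ?I)"
    let ?B = "bernoulli_pmf (1 / real ?r)"
    let ?F = "\<lambda>q. Track e ?y ?r (map_option (second_edge e (\<tau> @ [u])) q)"
    have "process sampler_step (return_pmf (Track e y 0 None)) (\<tau> @ [u]) =
      bind_pmf (uniform_option ?I) (\<lambda>q. bind_pmf ?B (\<lambda>b. return_pmf (if b then ?F (Some (length \<tau>)) else ?F q)))"
      using True
      by (auto simp: snoc bind_map_pmf map_pmf_def[of _ ?B] count_from_snoc second second_edge_snoc
          simp del: of_nat_Suc intro!: bind_pmf_cong)
    \<comment> \<open>The coin is independent of the old index; tossing it first brings the step
      into the form of \<open>uniform_option_insert\<close>.\<close>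
    also have "\<dots> = bind_pmf ?B (\<lambda>b. bind_pmf (uniform_option ?I)
        (\<lambda>q. return_pmf (if b then ?F (Some (length \<tau>)) else ?F q)))"
      by (rule bind_commute_pmf)
    also have "\<dots> = map_pmf ?F (bind_pmf ?B (\<lambda>b. if b then return_pmf (Some (length \<tau>)) else uniform_option ?I))"
      by (auto simp: map_bind_pmf map_pmf_def[symmetric] intro!: bind_pmf_cong)
    also have "\<dots> = map_pmf ?F (uniform_option (insert (length \<tau>) ?I))"
      by (simp add: uniform_option_insert nI)
    finally show ?thesis
      using True nI by (simp add: incidences_snoc)
  qed
qed

lemma process_Wait:
  "t < length \<sigma> \<Longrightarrow> process sampler_step (return_pmf (Wait t)) \<sigma> =
    process sampler_step (return_pmf (Track (fst (\<sigma> ! t)) (max 0 (snd (\<sigma> ! t))) 0 None)) (drop (Suc t) \<sigma>)"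
proof (induction \<sigma> arbitrary: t)
  case (Cons u \<sigma>)
  then show ?case by (cases t) (simp_all add: bind_return_pmf)
qed simp

section \<open>Moments of the sampled value\<close>

definition hit :: "update list \<Rightarrow> nat \<Rightarrow> nat \<Rightarrow> bool" where
  "hit \<sigma> t s \<longleftrightarrow> (let e = fst (\<sigma> ! t); \<tau> = drop (Suc t) \<sigma> in
     count_from sticky e (max 0 (snd (\<sigma> ! t))) \<tau> = 1 \<and> snd (second_edge e \<tau> s) = (1, 1))"

definition hits :: "update list \<Rightarrow> (nat \<times> nat) set" where
  "hits \<sigma> = {(t, s). t < length \<sigma> \<and> s \<in> incidences (fst (\<sigma> ! t)) (drop (Suc t) \<sigma>) \<and> hit \<sigma> t s}"

lemma finite_hits [simp]: "finite (hits \<sigma>)"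
  by (rule finite_subset[of _ "SIGMA t:{..<length \<sigma>}. incidences (fst (\<sigma> ! t)) (drop (Suc t) \<sigma>)"])
    (auto simp: hits_def)

lemma process_sampler_init:
  "process sampler_step (sampler_init L) \<sigma> =
     bind_pmf (pmf_of_set {..<L}) (\<lambda>t. process sampler_step (return_pmf (Wait t)) \<sigma>)"
  by (simp add: sampler_init_def map_pmf_def process_bind_pmf)

text \<open>A hit is sampled with probability 1/(L r) and contributes (L r)^(m + 1), so one factor
  cancels. The case m = 0 counts the hits, m = 1 gives the second moment. As the exponent is
  positive, an empty reservoir contributes 0.\<close>

lemma sampler_moment:
  assumes L: "length \<sigma> = L" "L > 0"
  shows "measure_pmf.expectation (process sampler_step (sampler_init L) \<sigma>)
      (\<lambda>x. sampler_value L x ^ Suc m) =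
    (\<Sum>(t, s)\<in>hits \<sigma>. (real L * real (card (incidences (fst (\<sigma> ! t)) (drop (Suc t) \<sigma>)))) ^ m)"
proof -
  let ?I = "\<lambda>t. incidences (fst (\<sigma> ! t)) (drop (Suc t) \<sigma>)"
  let ?p = "\<lambda>t. process sampler_step (return_pmf (Wait t)) \<sigma>"
  have *: "measure_pmf.expectation (?p t) (\<lambda>x. sampler_value L x ^ Suc m) =
      (\<Sum>s\<in>?I t. if hit \<sigma> t s then real L * (real L * real (card (?I t))) ^ m else 0)"
    if "t < L" for t
  proof -
    have val: "sampler_value L (Track (fst (\<sigma> ! t))
          (count_from sticky (fst (\<sigma> ! t)) (max 0 (snd (\<sigma> ! t))) (drop (Suc t) \<sigma>)) (card (?I t))
          (Some (second_edge (fst (\<sigma> ! t)) (drop (Suc t) \<sigma>) s))) =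
        (if hit \<sigma> t s then real L * real (card (?I t)) else 0)" for s
      by (cases "second_edge (fst (\<sigma> ! t)) (drop (Suc t) \<sigma>) s") (simp add: hit_def Let_def)
    have "measure_pmf.expectation (?p t) (\<lambda>x. sampler_value L x ^ Suc m) =
        (\<Sum>s\<in>?I t. (if hit \<sigma> t s then real L * real (card (?I t)) else 0) ^ Suc m) / real (card (?I t))"
      using that L(1)
      by (simp add: process_Wait process_Track expectation_uniform_option val del: power_Suc)
    \<comment> \<open>The uniform choice from the reservoir cancels one factor
      \<open>card (?I t)\<close>, nonzero because \<open>s\<close> lies in \<open>?I t\<close>. One
      factor \<open>real L\<close> is left for the uniform choice of \<open>t\<close> to
      cancel.\<close>
    moreover have "(if hit \<sigma> t s then real L * real (card (?I t)) else 0) ^ Suc m / real (card (?I t)) =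
        (if hit \<sigma> t s then real L * (real L * real (card (?I t))) ^ m else 0)" if "s \<in> ?I t" for s
    proof -
      have "card (?I t) \<noteq> 0" using that by (auto simp: card_eq_0_iff)
      then show ?thesis by simp
    qed
    ultimately show ?thesis by (simp add: sum_divide_distrib del: power_Suc)
  qed
  have fin: "finite (set_pmf (?p t))" if "t < L" for t
    using that L
    by (auto simp: process_Wait process_Track uniform_option_def)
  have "measure_pmf.expectation (process sampler_step (sampler_init L) \<sigma>) (\<lambda>x. sampler_value L x ^ Suc m)
    = (\<Sum>t<L. measure_pmf.expectation (?p t) (\<lambda>x. sampler_value L x ^ Suc m) / real L)"
    unfolding process_sampler_init
    using L fin by (subst pmf_expectation_bind_pmf_of_set) (auto simp: divide_inverse mult.commute)
  also have "\<dots> = (\<Sum>t<L. \<Sum>s\<in>?I t. if hit \<sigma> t s then (real L * real (card (?I t))) ^ m else 0)"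
    using L(2) by (intro sum.cong refl) (auto simp: * sum_divide_distrib simp del: power_Suc intro!: sum.cong)
  also have "\<dots> = (\<Sum>(t, s)\<in>(SIGMA t:{..<L}. ?I t). if hit \<sigma> t s then (real L * real (card (?I t))) ^ m else 0)"
    by (subst sum.Sigma) auto
  also have "\<dots> = (\<Sum>(t, s)\<in>hits \<sigma>. (real L * real (card (?I t))) ^ m)"
    using L by (intro sum.mono_neutral_cong_right) (auto simp: hits_def split: if_splits)
  finally show ?thesis .
qed

lemma finite_set_process_sampler:
  assumes "length \<sigma> = L" "L > 0"
  shows "finite (set_pmf (process sampler_step (sampler_init L) \<sigma>))"
proof -
  have "{..<L} \<noteq> {}" using assms by auto
  then show ?thesis
    using assms by (auto simp: process_sampler_init process_Wait process_Track uniform_option_def)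
qed

section \<open>Range of the counters and number of sampler states\<close>

text \<open>An update moves a counter by at most \<open>K\<close>, so \<open>i * K\<close> bounds
  all counters after \<open>i\<close> updates, whatever the multiplicities are.\<close>

definition sampler_states :: "nat set set \<Rightarrow> nat \<Rightarrow> nat \<Rightarrow> nat \<Rightarrow> sampler set" where
  "sampler_states E L K i = Wait ` {..<L} \<union>
    (\<lambda>(e, y, r, q). Track e y r q) ` (E \<times> {0..int (i * K)} \<times> {0..i} \<times>
      insert None (Some ` (E \<times> {0..int (i * K)} \<times> {0..int (i * K)})))"

lemma sampler_states_simps [simp]:
  "Wait j \<in> sampler_states E L K i \<longleftrightarrow> j < L"
  "Track e y r q \<in> sampler_states E L K i \<longleftrightarrow> e \<in> E \<and> 0 \<le> y \<and> y \<le> int (i * K) \<and> r \<le> i \<and>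
    (case q of None \<Rightarrow> True | Some (f, a, b) \<Rightarrow>
       f \<in> E \<and> 0 \<le> a \<and> a \<le> int (i * K) \<and> 0 \<le> b \<and> b \<le> int (i * K))"
proof -
  show "Wait j \<in> sampler_states E L K i \<longleftrightarrow> j < L"
    by (auto simp: sampler_states_def)
  show "Track e y r q \<in> sampler_states E L K i \<longleftrightarrow> e \<in> E \<and> 0 \<le> y \<and> y \<le> int (i * K) \<and> r \<le> i \<and>
    (case q of None \<Rightarrow> True | Some (f, a, b) \<Rightarrow>
       f \<in> E \<and> 0 \<le> a \<and> a \<le> int (i * K) \<and> 0 \<le> b \<and> b \<le> int (i * K))"
    by (cases q) (auto simp: sampler_states_def image_iff simp del: of_nat_mult)
qed

lemma sampler_states_mono:
  assumes "i \<le> j"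
  shows "sampler_states E L K i \<subseteq> sampler_states E L K j"
proof -
  have K: "int (i * K) \<le> int (j * K)" using assms by (simp add: mult_mono)
  with assms show ?thesis
    unfolding sampler_states_def
    by (intro Un_mono image_mono Sigma_mono insert_mono order_refl)
      (auto simp del: of_nat_mult intro!: imageI intro: order_trans[OF _ K])
qed

lemma on_edge_bounds:
  assumes "0 \<le> y" "y \<le> int (i * K)" "\<bar>snd u\<bar> \<le> int K" "g = sticky \<or> g = reflected"
  shows "0 \<le> on_edge g e u y" "on_edge g e u y \<le> int (Suc i * K)"
  using assms by (auto simp: on_edge_def sticky_def reflected_def)

lemma sampler_step_states:
  assumes x: "x \<in> sampler_states E L K i" and u: "fst u \<in> E" "\<bar>snd u\<bar> \<le> int K"
  shows "set_pmf (sampler_step u x) \<subseteq> sampler_states E L K (Suc i)"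
proof (cases x)
  case (Wait j)
  have "max 0 (snd u) \<le> int (Suc i * K)" using u by (simp add: add_increasing2)
  with Wait show ?thesis using x u by (auto simp del: of_nat_mult mult_Suc)
next
  case (Track e y r q)
  have q: "case map_option (follow e u) q of None \<Rightarrow> True | Some (f, a, b) \<Rightarrow>
      f \<in> E \<and> 0 \<le> a \<and> a \<le> int (Suc i * K) \<and> 0 \<le> b \<and> b \<le> int (Suc i * K)"
    using x u unfolding Track sampler_states_simps
    by (cases q) (auto simp del: of_nat_mult mult_Suc intro!: on_edge_bounds)
  have y: "0 \<le> on_edge sticky e u y" "on_edge sticky e u y \<le> int (Suc i * K)"
    using x u unfolding Track sampler_states_simps by (auto simp del: of_nat_mult mult_Suc intro!: on_edge_bounds)
  have v: "max 0 (snd u) \<le> int (Suc i * K)" using u by (simp add: add_increasing2)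
  show ?thesis
    using x u q y v unfolding Track sampler_step.simps
    by (auto simp del: of_nat_mult mult_Suc)
qed

lemma set_process_sampler:
  assumes u: "\<And>u. u \<in> set \<sigma> \<Longrightarrow> fst u \<in> E \<and> \<bar>snd u\<bar> \<le> int K" and L: "length \<sigma> \<le> L" "L > 0"
  shows "set_pmf (process sampler_step (sampler_init L) \<sigma>) \<subseteq> sampler_states E L K L"
proof -
  have "{..<L} \<noteq> {}" using L by auto
  then have "set_pmf (process sampler_step (sampler_init L) \<sigma>) \<subseteq> sampler_states E L K (length \<sigma>)"
    by (intro process_subset[where I = "sampler_states E L K"] sampler_step_states)
      (auto simp: sampler_init_def u)
  with sampler_states_mono[OF L(1)] show ?thesis by blast
qed

lemma finite_sampler_states: "finite E \<Longrightarrow> finite (sampler_states E L K i)"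
  by (simp add: sampler_states_def)

lemma card_sampler_states:
  assumes "finite E"
  shows "card (sampler_states E L K i) \<le>
    L + card E * ((i * K + 1) * ((i + 1) * (1 + card E * (i * K + 1)\<^sup>2)))"
proof -
  let ?Q = "insert None (Some ` (E \<times> {0..int (i * K)} \<times> {0..int (i * K)}))"
  have Q: "card ?Q \<le> 1 + card E * (i * K + 1)\<^sup>2"
    using assms
    by (subst card_insert_disjoint) (auto simp: card_image card_cartesian_product power2_eq_square nat_add_distrib
        simp flip: of_nat_mult)
  have "card (sampler_states E L K i) \<le> card {..<L} + card (E \<times> {0..int (i * K)} \<times> {0..i} \<times> ?Q)"
    unfolding sampler_states_def using assms
    by (intro order_trans[OF card_Un_le] add_mono card_image_le) auto
  also have "\<dots> = L + card E * ((i * K + 1) * ((i + 1) * card ?Q))"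
    unfolding card_cartesian_product by (simp add: nat_add_distrib flip: of_nat_mult)
  also have "\<dots> \<le> L + card E * ((i * K + 1) * ((i + 1) * (1 + card E * (i * K + 1)\<^sup>2)))"
    by (intro add_left_mono mult_left_mono Q) auto
  finally show ?thesis .
qed

section \<open>Births and triangles\<close>

text \<open>Positions start at 0: \<open>take i \<sigma>\<close> is the stream just before the
  update and \<open>take (Suc i) \<sigma>\<close> the stream just after it. The case
  \<open>j = length \<sigma>\<close> says that the edge is present at the end.\<close>

definition birth :: "update list \<Rightarrow> nat set \<Rightarrow> nat \<Rightarrow> bool" where
  "birth \<sigma> e i \<longleftrightarrow> i < length \<sigma> \<and> freq (take i \<sigma>) e = 0 \<and>
     (\<forall>j. i < j \<longrightarrow> j \<le> length \<sigma> \<longrightarrow> 1 \<le> freq (take j \<sigma>) e)"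

lemma freq_Nil [simp]: "freq [] e = 0"
  by (simp add: freq_def)

lemma freq_snoc: "freq (\<sigma> @ [u]) e = freq \<sigma> e + (if fst u = e then snd u else 0)"
  by (simp add: freq_def case_prod_unfold)

lemma freq_take_Suc:
  "i < length \<sigma> \<Longrightarrow> freq (take (Suc i) \<sigma>) e = freq (take i \<sigma>) e + (if fst (\<sigma> ! i) = e then snd (\<sigma> ! i) else 0)"
  by (simp add: take_Suc_conv_app_nth freq_snoc)

text \<open>The multiplicity rises from 0 at this update, so the update must be to
  \<open>e\<close>.\<close>

lemma birth_edge: "birth \<sigma> e i \<Longrightarrow> fst (\<sigma> ! i) = e"
  using freq_take_Suc[of i \<sigma> e] by (auto simp: birth_def dest!: spec[of _ "Suc i"] split: if_splits)

lemma birth_unique: "birth \<sigma> e i \<Longrightarrow> birth \<sigma> e j \<Longrightarrow> i = j"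
  unfolding birth_def by (metis less_imp_le linorder_neqE_nat not_one_le_zero)

lemma birth_final: "birth \<sigma> e i \<Longrightarrow> 1 \<le> freq \<sigma> e"
  unfolding birth_def by (metis order_refl take_all)

text \<open>The birth is the last prefix of multiplicity 0, hence not before any given zero
  \<open>z\<close>.\<close>

lemma birth_from_zero:
  assumes nonneg: "\<And>j. j \<le> length \<sigma> \<Longrightarrow> 0 \<le> freq (take j \<sigma>) e"
    and final: "freq \<sigma> e = 1" and zero: "z \<le> length \<sigma>" "freq (take z \<sigma>) e = 0"
  obtains i where "z \<le> i" "birth \<sigma> e i"
proof -
  let ?Z = "{i. i \<le> length \<sigma> \<and> freq (take i \<sigma>) e = 0}"
  define i where "i = Max ?Z"
  have fin: "finite ?Z" by simp
  have "i \<in> ?Z" unfolding i_def using zero by (intro Max_in) auto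
  moreover have "z \<le> i" unfolding i_def using zero by (intro Max_ge fin) auto
  moreover have "1 \<le> freq (take j \<sigma>) e" if "i < j" "j \<le> length \<sigma>" for j
    using Max_ge[OF fin, of j] that nonneg[of j] unfolding i_def[symmetric] by force
  moreover have "i \<noteq> length \<sigma>" using \<open>i \<in> ?Z\<close> final by auto
  ultimately show thesis using that unfolding birth_def by force
qed

section \<open>What the final counter values say about births\<close>

text \<open>A sticky counter started at position \<open>i\<close> reaches 1 iff no later prefix falls back to the
  multiplicity before \<open>i\<close>; since the final multiplicity is at most 1, that multiplicity
  was 0.\<close>

lemma sticky_count:
  assumes "i < length \<sigma>" "fst (\<sigma> ! i) = e" "Suc i \<le> m" "m \<le> length \<sigma>"
  shows "count_from sticky e (max 0 (snd (\<sigma> ! i))) (drop (Suc i) (take m \<sigma>)) =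
    (if \<forall>j. i < j \<longrightarrow> j \<le> m \<longrightarrow> 1 \<le> freq (take j \<sigma>) e - freq (take i \<sigma>) e
     then freq (take m \<sigma>) e - freq (take i \<sigma>) e else 0)"
  using assms(3,4)
proof (induction m rule: dec_induct)
  \<comment> \<open>The only prefix to check ends just after the update, and the start value is
    nonzero iff the update raises the multiplicity by at least 1.\<close>
  case base
  then show ?case
    using assms(1,2) by (auto simp: count_from_def freq_take_Suc le_Suc_eq less_Suc_eq)
next
  case (step k)
  let ?x = "\<lambda>j. freq (take j \<sigma>) e"
  let ?P = "\<lambda>m. \<forall>j. i < j \<longrightarrow> j \<le> m \<longrightarrow> 1 \<le> ?x j - ?x i"
  have "drop (Suc i) (take (Suc k) \<sigma>) = drop (Suc i) (take k \<sigma>) @ [\<sigma> ! k]"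
    using step by (simp add: take_Suc_conv_app_nth)
  then have "count_from sticky e (max 0 (snd (\<sigma> ! i))) (drop (Suc i) (take (Suc k) \<sigma>)) =
      on_edge sticky e (\<sigma> ! k) (if ?P k then ?x k - ?x i else 0)"
    using step by (simp only: count_from_snoc Suc_leD)
  also have "\<dots> = (if ?P k \<and> 1 \<le> ?x (Suc k) - ?x i then ?x (Suc k) - ?x i else 0)"
  proof (cases "?P k")
    case True
    then have "1 \<le> ?x k - ?x i" using step by auto
    with True show ?thesis using step.prems by (auto simp: on_edge_def sticky_def freq_take_Suc)
  qed (auto simp: on_edge_def sticky_def)
  also have "?P k \<and> 1 \<le> ?x (Suc k) - ?x i \<longleftrightarrow> ?P (Suc k)"
    using le_imp_less_Suc[OF Suc_leD[OF step.hyps(1)]] by (auto simp: le_Suc_eq)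
  finally show ?case .
qed

text \<open>Multiplicity minus counter is the running minimum of the multiplicity from prefix
  \<open>i\<close> on, expressed as a lower bound that is attained.\<close>

lemma reflected_count:
  fixes \<sigma> :: "update list" and e :: "nat set"
  assumes "i \<le> m" "m \<le> length \<sigma>"
  shows "(\<forall>j. i \<le> j \<longrightarrow> j \<le> m \<longrightarrow>
      freq (take m \<sigma>) e - count_from reflected e 0 (drop i (take m \<sigma>)) \<le> freq (take j \<sigma>) e) \<and>
    (\<exists>j. i \<le> j \<and> j \<le> m \<and>
      freq (take m \<sigma>) e - count_from reflected e 0 (drop i (take m \<sigma>)) = freq (take j \<sigma>) e)"
  using assms
proof (induction m rule: dec_induct)
  case base
  then show ?case by (auto simp: count_from_def)
next
  case (step m)
  let ?x = "\<lambda>j. freq (take j \<sigma>) e" and ?y = "\<lambda>m. count_from reflected e 0 (drop i (take m \<sigma>))"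
  have *: "drop i (take (Suc m) \<sigma>) = drop i (take m \<sigma>) @ [\<sigma> ! m]"
    using step by (simp add: take_Suc_conv_app_nth)
  from step.IH step.prems have IH: "\<forall>j. i \<le> j \<longrightarrow> j \<le> m \<longrightarrow> ?x m - ?y m \<le> ?x j"
    "\<exists>j. i \<le> j \<and> j \<le> m \<and> ?x m - ?y m = ?x j" by auto
  have "?y (Suc m) = on_edge reflected e (\<sigma> ! m) (?y m)"
    by (simp only: * count_from_snoc)
  moreover have "?y m \<ge> 0" using IH(1) step.hyps by auto
  \<comment> \<open>The cut at 0 in \<open>reflected\<close> happens exactly when the new
    multiplicity falls below the old minimum, so the difference obeys the recursion of a running
    minimum.\<close>
  ultimately have y: "?x (Suc m) - ?y (Suc m) = min (?x m - ?y m) (?x (Suc m))"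
    using step.prems by (auto simp: on_edge_def reflected_def freq_take_Suc max_def min_def)
  show ?case
  proof
    show "\<forall>j. i \<le> j \<longrightarrow> j \<le> Suc m \<longrightarrow> ?x (Suc m) - ?y (Suc m) \<le> ?x j"
      using IH(1) unfolding y by (auto simp: le_Suc_eq min_le_iff_disj)
    show "\<exists>j. i \<le> j \<and> j \<le> Suc m \<and> ?x (Suc m) - ?y (Suc m) = ?x j"
      using IH(2) step.hyps unfolding y min_def by (auto intro: le_SucI)
  qed
qed

lemma sticky_eq_1_iff:
  assumes "i < length \<sigma>" "fst (\<sigma> ! i) = e"
    and nonneg: "\<And>j. j \<le> length \<sigma> \<Longrightarrow> 0 \<le> freq (take j \<sigma>) e" and final: "freq \<sigma> e \<in> {0, 1}"
  shows "count_from sticky e (max 0 (snd (\<sigma> ! i))) (drop (Suc i) \<sigma>) = 1 \<longleftrightarrow> birth \<sigma> e i"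
    (is "?c = 1 \<longleftrightarrow> _")
proof -
  have c: "?c = (if \<forall>j. i < j \<longrightarrow> j \<le> length \<sigma> \<longrightarrow> 1 \<le> freq (take j \<sigma>) e - freq (take i \<sigma>) e
     then freq \<sigma> e - freq (take i \<sigma>) e else 0)"
    using sticky_count[OF assms(1,2) Suc_leI[OF assms(1)] order_refl]
    by (simp only: take_all[OF order_refl])
  show ?thesis
  proof
    assume "?c = 1"
    then have all: "\<forall>j. i < j \<longrightarrow> j \<le> length \<sigma> \<longrightarrow> 1 \<le> freq (take j \<sigma>) e - freq (take i \<sigma>) e"
      and "freq \<sigma> e - freq (take i \<sigma>) e = 1"
      unfolding c by (auto split: if_splits)
    with final nonneg[of i] assms(1) have "freq (take i \<sigma>) e = 0" by auto
    with all assms(1) show "birth \<sigma> e i" by (simp add: birth_def)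
  next
    assume "birth \<sigma> e i"
    with final birth_final[of \<sigma> e i] show "?c = 1"
      unfolding c by (auto simp: birth_def)
  qed
qed

text \<open>The counter is the final multiplicity minus the minimum from prefix \<open>i\<close> on.
  With the final multiplicity at most 1 and the minimum at least 0, it is 1 iff these are 1 and 0;
  the last zero is then the birth.\<close>

lemma reflected_eq_1_iff:
  assumes "i \<le> length \<sigma>"
    and nonneg: "\<And>j. j \<le> length \<sigma> \<Longrightarrow> 0 \<le> freq (take j \<sigma>) e" and final: "freq \<sigma> e \<in> {0, 1}"
  shows "count_from reflected e 0 (drop i \<sigma>) = 1 \<longleftrightarrow> (\<exists>j\<ge>i. birth \<sigma> e j)" (is "?c = 1 \<longleftrightarrow> _")
proof -
  obtain z where z: "i \<le> z" "z \<le> length \<sigma>" "freq \<sigma> e - ?c = freq (take z \<sigma>) e"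
    and le: "\<And>j. i \<le> j \<Longrightarrow> j \<le> length \<sigma> \<Longrightarrow> freq \<sigma> e - ?c \<le> freq (take j \<sigma>) e"
    using reflected_count[OF assms(1) order_refl, of e] by auto
  show ?thesis
  proof
    assume "?c = 1"
    with z final nonneg[of z] have "freq \<sigma> e = 1" "freq (take z \<sigma>) e = 0" by auto
    then obtain j where "z \<le> j" "birth \<sigma> e j"
      using birth_from_zero[of \<sigma> e z] nonneg z by blast
    with z show "\<exists>j\<ge>i. birth \<sigma> e j" by (auto intro: order_trans)
  next
    assume "\<exists>j\<ge>i. birth \<sigma> e j"
    then obtain j where j: "i \<le> j" "birth \<sigma> e j" by blast
    then have "freq (take j \<sigma>) e = 0" "j \<le> length \<sigma>" "freq \<sigma> e = 1"
      using birth_final final by (auto simp: birth_def)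
    with le[of j] z nonneg[of z] j show "?c = 1" by auto
  qed
qed

section \<open>Triangles, their sides and their number\<close>

text \<open>A pair inside \<open>S\<close> is the complement of one vertex. The sides
  \<open>e\<close> and \<open>f\<close> omit one vertex each, and the closing side omits their
  common vertex.\<close>

lemma pairs_of_three:
  assumes "card S = 3" "e \<subseteq> S" "f \<subseteq> S" "card e = 2" "card f = 2" "e \<noteq> f"
  shows "e \<union> f = S" "incident e f" "closing e f \<subseteq> S" "card (closing e f) = 2"
    "closing e f \<noteq> e" "closing e f \<noteq> f"
    and "\<And>g. g \<subseteq> S \<Longrightarrow> card g = 2 \<Longrightarrow> g = e \<or> g = f \<or> g = closing e f"
proof -
  have fin: "finite S" using assms(1) by (simp add: card_ge_0_finite)
  have co: "\<exists>w\<in>S. g = S - {w}" if "g \<subseteq> S" "card g = 2" for g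
  proof -
    have "card (S - g) = 1"
      using that assms(1) fin finite_subset[OF that(1) fin] by (simp add: card_Diff_subset)
    then obtain w where "S - g = {w}" by (rule card_1_singletonE)
    with that(1) show ?thesis by blast
  qed
  obtain y z where yz: "y \<in> S" "z \<in> S" "e = S - {z}" "f = S - {y}" "y \<noteq> z"
    using co[OF assms(2,4)] co[OF assms(3,5)] assms(6) by blast
  have "card (S - {y, z}) = 1"
    using yz assms(1) fin by (simp add: card_Diff_subset)
  then obtain x where "S - {y, z} = {x}" by (rule card_1_singletonE)
  then have S: "S = {x, y, z}" "x \<noteq> y" "x \<noteq> z" using yz by auto
  have e: "e = {x, y}" and f: "f = {x, z}" and cl: "closing e f = {y, z}"
    using yz S by (auto simp: closing_def)
  show "e \<union> f = S" "incident e f" "closing e f \<subseteq> S" "card (closing e f) = 2"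
    "closing e f \<noteq> e" "closing e f \<noteq> f"
    unfolding cl using e f S yz(5) by (auto simp: incident_def doubleton_eq_iff)
  show "g = e \<or> g = f \<or> g = closing e f" if g: "g \<subseteq> S" "card g = 2" for g
  proof -
    obtain w where "w \<in> S" "g = S - {w}" using co[OF g] by blast
    moreover have "S - {x} = {y, z}" using S yz(5) by auto
    ultimately show ?thesis unfolding cl using yz(3,4) S(1) by auto
  qed
qed

lemma card_Un_incident:
  assumes "card e = 2" "card f = 2" "incident e f"
  shows "card (e \<union> f) = 3"
proof -
  have fin: "finite e" "finite f" using assms by (auto intro: card_ge_0_finite)
  have "card (e \<inter> f) \<noteq> 0" using assms fin by (auto simp: incident_def)
  moreover have "card (e \<inter> f) \<noteq> 2"
    using assms fin by (metis card_subset_eq incident_def inf_le1 inf_le2)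
  moreover have "card (e \<inter> f) \<le> 2"
    using card_mono[OF fin(1), of "e \<inter> f"] assms by auto
  ultimately have "card (e \<inter> f) = 1" by linarith
  with card_Un_Int[OF fin] assms show ?thesis by simp
qed

lemma finite_complete_edges [simp]: "finite (complete_edges n)"
  by (rule finite_subset[of _ "Pow {1..n}"]) (auto simp: complete_edges_def)

lemma card_complete_edges: "card (complete_edges n) \<le> n\<^sup>2"
proof -
  have "complete_edges n \<subseteq> (\<lambda>(a, b). {a, b}) ` ({1..n} \<times> {1..n})"
    by (auto simp: complete_edges_def card_2_iff image_iff)
  then have "card (complete_edges n) \<le> card ({1..n} \<times> {1..n})"
    by (meson card_image_le card_mono finite_SigmaI finite_atLeastAtMost finite_imageI order_trans)
  then show ?thesis by (simp add: power2_eq_square)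
qed

lemma finite_final_graph [simp]: "finite (final_graph n \<sigma>)"
  by (simp add: final_graph_def)

lemma triangle_two_edges:
  assumes "S \<in> triangles F" "v \<in> S"
  obtains e f where "e \<in> F" "f \<in> F" "v \<in> e" "v \<in> f" "S = e \<union> f"
proof -
  have "card (S - {v}) = 2" using assms by (simp add: triangles_def)
  then obtain a b where ab: "S - {v} = {a, b}" "a \<noteq> b" by (auto simp: card_2_iff)
  have "S = insert v (S - {v})" "v \<notin> S - {v}" using assms(2) by blast+
  then have S: "S = {v, a} \<union> {v, b}" and "v \<noteq> a" "v \<noteq> b" unfolding ab(1) by auto
  then have "{v, a} \<subseteq> S \<and> card {v, a} = 2" "{v, b} \<subseteq> S \<and> card {v, b} = 2" by simp_all
  have F: "\<forall>e. e \<subseteq> S \<and> card e = 2 \<longrightarrow> e \<in> F" using assms(1) by (simp add: triangles_def)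
  have "{v, a} \<in> F" by (rule F[rule_format]) fact
  moreover have "{v, b} \<in> F" by (rule F[rule_format]) fact
  ultimately show thesis by (rule that) (simp_all add: S)
qed

lemma triangle_subset:
  assumes S: "S \<in> triangles (final_graph n \<sigma>)"
  shows "S \<subseteq> {1..n}"
proof -
  have "S \<noteq> {}" using S by (auto simp: triangles_def)
  then obtain v where "v \<in> S" by blast
  with S obtain e f where "e \<in> final_graph n \<sigma>" "f \<in> final_graph n \<sigma>" "S = e \<union> f"
    by (rule triangle_two_edges)
  then show ?thesis by (auto simp: final_graph_def complete_edges_def)
qed

lemma finite_triangles [simp]: "finite (triangles (final_graph n \<sigma>))"
  by (rule finite_subset[of _ "Pow {1..n}"]) (use triangle_subset in auto)

text \<open>A triangle at \<open>v\<close> is the union of its two sides at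
  \<open>v\<close>.\<close>

lemma card_triangles_at:
  assumes "finite F"
  shows "card {S \<in> triangles F. v \<in> S} \<le> (degree F v)\<^sup>2"
proof -
  let ?D = "{e \<in> F. v \<in> e}"
  have "{S \<in> triangles F. v \<in> S} \<subseteq> (\<lambda>(e, f). e \<union> f) ` (?D \<times> ?D)"
    by (auto elim!: triangle_two_edges simp: image_iff)
  moreover have fin: "finite (?D \<times> ?D)" using assms by simp
  ultimately have "card {S \<in> triangles F. v \<in> S} \<le> card (?D \<times> ?D)"
    by (intro order_trans[OF card_mono card_image_le[OF fin]] finite_imageI)
  then show ?thesis by (simp add: degree_def power2_eq_square card_cartesian_product)
qed

text \<open>A triangle is the union of an edge and a second edge at one of its two ends, which
  leaves at most \<open>2 * d\<close> choices per edge. A bound linear in \<open>card F\<close>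
  allows \<open>T\<close> to be compared with the stream length.\<close>

lemma card_triangles_le:
  assumes "finite F" "\<And>e. e \<in> F \<Longrightarrow> card e = 2" "\<And>e v. e \<in> F \<Longrightarrow> v \<in> e \<Longrightarrow> degree F v \<le> d"
  shows "card (triangles F) \<le> 2 * d * card F"
proof -
  let ?N = "\<lambda>e. \<Union>v\<in>e. {f \<in> F. v \<in> f}"
  have N: "card (?N e) \<le> 2 * d" if "e \<in> F" for e
  proof -
    have "finite e" using assms(2)[OF that] by (simp add: card_ge_0_finite)
    then have "card (?N e) \<le> (\<Sum>v\<in>e. card {f \<in> F. v \<in> f})" by (rule card_UN_le)
    also have "\<dots> \<le> (\<Sum>v\<in>e. d)" using assms(3)[OF that] by (intro sum_mono) (simp add: degree_def)
    finally show ?thesis using assms(2)[OF that] by simp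
  qed
  have "S \<in> (\<lambda>(e, f). e \<union> f) ` (SIGMA e:F. ?N e)" if S: "S \<in> triangles F" for S
  proof -
    have "S \<noteq> {}" using S by (auto simp: triangles_def)
    then obtain v where "v \<in> S" by blast
    then obtain e f where "e \<in> F" "f \<in> F" "v \<in> e" "v \<in> f" "S = e \<union> f"
      using triangle_two_edges[OF S] by blast
    then show ?thesis by (intro image_eqI[of _ _ "(e, f)"]) auto
  qed
  then have "card (triangles F) \<le> card ((\<lambda>(e, f). e \<union> f) ` (SIGMA e:F. ?N e))"
    using assms(1) by (intro card_mono finite_imageI finite_SigmaI finite_subset[of "?N _" F]) auto
  also have "\<dots> \<le> card (SIGMA e:F. ?N e)"
    using assms(1) by (intro card_image_le finite_SigmaI finite_subset[of "?N _" F]) auto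
  also have "\<dots> = (\<Sum>e\<in>F. card (?N e))"
    using assms(1) by (intro card_SigmaI) (auto intro: finite_subset[of "?N _" F])
  also have "\<dots> \<le> (\<Sum>e\<in>F. 2 * d)" by (intro sum_mono N)
  finally show ?thesis by (simp add: mult.commute)
qed

section \<open>Hits correspond to triangles\<close>

locale strict_stream =
  fixes n :: nat and \<sigma> :: "update list"
  assumes edges: "fst ` set \<sigma> \<subseteq> complete_edges n"
    and nonneg: "\<And>j e. j \<le> length \<sigma> \<Longrightarrow> e \<in> complete_edges n \<Longrightarrow> 0 \<le> freq (take j \<sigma>) e"
    and final: "\<And>e. e \<in> complete_edges n \<Longrightarrow> freq \<sigma> e \<in> {0, 1}"
begin

abbreviation "F \<equiv> final_graph n \<sigma>"

lemma nth_edge: "i < length \<sigma> \<Longrightarrow> fst (\<sigma> ! i) \<in> complete_edges n"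
  using edges nth_mem[of i \<sigma>] by blast

lemma final_graph_iff: "e \<in> F \<longleftrightarrow> e \<in> complete_edges n \<and> (\<exists>i. birth \<sigma> e i)"
proof -
  have "\<exists>i. birth \<sigma> e i" if "e \<in> F"
  proof -
    have "e \<in> complete_edges n" "freq \<sigma> e = 1" using that by (auto simp: final_graph_def)
    then obtain i where "birth \<sigma> e i"
      by (rule_tac birth_from_zero[of \<sigma> e 0]) (simp_all add: nonneg)
    then show ?thesis ..
  qed
  moreover have "freq \<sigma> e = 1" if "e \<in> complete_edges n" "birth \<sigma> e i" for i
    using birth_final[OF that(2)] final[OF that(1)] by auto
  ultimately show ?thesis by (auto simp: final_graph_def)
qed

lemma card_final_graph: "card F \<le> length \<sigma>"
proof -
  have "e \<in> fst ` set \<sigma>" if "birth \<sigma> e i" for e i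
    using birth_edge[OF that] that by (auto simp: birth_def)
  then have "F \<subseteq> fst ` set \<sigma>" by (auto simp: final_graph_iff)
  then have "card F \<le> card (fst ` set \<sigma>)" by (intro card_mono) auto
  also have "\<dots> \<le> length \<sigma>" by (metis card_image_le card_length finite_set order_trans)
  finally show ?thesis .
qed

lemma closing_complete:
  assumes "e \<in> complete_edges n" "f \<in> complete_edges n" "incident e f"
  shows "closing e f \<in> complete_edges n"
  using pairs_of_three(4)[of "e \<union> f" e f] card_Un_incident[of e f] assms
  by (auto simp: complete_edges_def incident_def closing_def)

text \<open>The three counter tests become births of the picked, the held and the closing edge, in
  this order.\<close>

lemma hits_iff:
  "(t, s) \<in> hits \<sigma> \<longleftrightarrow> Suc t + s < length \<sigma> \<and>
     incident (fst (\<sigma> ! t)) (fst (\<sigma> ! (Suc t + s))) \<and>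
     birth \<sigma> (fst (\<sigma> ! t)) t \<and> birth \<sigma> (fst (\<sigma> ! (Suc t + s))) (Suc t + s) \<and>
     (\<exists>k > Suc t + s. birth \<sigma> (closing (fst (\<sigma> ! t)) (fst (\<sigma> ! (Suc t + s)))) k)"
    (is "_ \<longleftrightarrow> ?R")
proof (cases "Suc t + s < length \<sigma> \<and> incident (fst (\<sigma> ! t)) (fst (\<sigma> ! (Suc t + s)))")
  case True
  let ?e = "fst (\<sigma> ! t)" and ?f = "fst (\<sigma> ! (Suc t + s))"
  have E: "?e \<in> complete_edges n" "?f \<in> complete_edges n" "closing ?e ?f \<in> complete_edges n"
    using True closing_complete nth_edge by auto
  \<comment> \<open>The counter of the closing edge starts after the held update, hence the bound
    \<open>Suc (Suc t + s)\<close> on its birth.\<close>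
  have "hit \<sigma> t s \<longleftrightarrow> birth \<sigma> ?e t \<and> birth \<sigma> ?f (Suc t + s) \<and> (\<exists>k \<ge> Suc (Suc t + s). birth \<sigma> (closing ?e ?f) k)"
    using True E
    by (simp add: hit_def second_edge_def Let_def add.commute[of s]
        sticky_eq_1_iff[of t] sticky_eq_1_iff[of "Suc (t + s)"] reflected_eq_1_iff nonneg final[simplified])
  moreover have "(t, s) \<in> hits \<sigma> \<longleftrightarrow> hit \<sigma> t s"
    using True by (auto simp: hits_def incidences_def)
  ultimately show ?thesis using True by (auto simp: Suc_le_eq)
next
  case False
  then show ?thesis by (auto simp: hits_def incidences_def)
qed

text \<open>The sides of a triangle have three distinct birth positions. The two earliest form a
  hit, and they are determined by the triangle because births are unique.\<close>

lemma bij_betw_hits_triangles: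
  "bij_betw (\<lambda>(t, s). fst (\<sigma> ! t) \<union> fst (\<sigma> ! (Suc t + s))) (hits \<sigma>) (triangles F)"
proof -
  let ?tri = "\<lambda>(t, s). fst (\<sigma> ! t) \<union> fst (\<sigma> ! (Suc t + s))"
  define R where "R S e i \<longleftrightarrow> e \<subseteq> S \<and> card e = 2 \<and> birth \<sigma> e i" for S e i
  have hit: "\<exists>e f k. card (?tri (t, s)) = 3 \<and> R (?tri (t, s)) e t \<and> R (?tri (t, s)) f (Suc t + s) \<and>
      R (?tri (t, s)) (closing e f) k \<and> Suc t + s < k \<and> e \<noteq> f" if "(t, s) \<in> hits \<sigma>" for t s
  proof -
    let ?e = "fst (\<sigma> ! t)" and ?f = "fst (\<sigma> ! (Suc t + s))"
    from that obtain k where k: "Suc t + s < length \<sigma>" "incident ?e ?f" "birth \<sigma> ?e t"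
      "birth \<sigma> ?f (Suc t + s)" "Suc t + s < k" "birth \<sigma> (closing ?e ?f) k"
      unfolding hits_iff by blast
    have "card ?e = 2" "card ?f = 2"
      using k(1) nth_edge[of t] nth_edge[of "Suc t + s"] by (auto simp: complete_edges_def)
    moreover have "card (?e \<union> ?f) = 3" using calculation k(2) by (rule card_Un_incident)
    ultimately have "card (closing ?e ?f) = 2" "closing ?e ?f \<subseteq> ?e \<union> ?f"
      using k(2) pairs_of_three(3,4)[of "?e \<union> ?f" ?e ?f] by (auto simp: incident_def)
    with k \<open>card ?e = 2\<close> \<open>card ?f = 2\<close> \<open>card (?e \<union> ?f) = 3\<close> show ?thesis
      unfolding R_def by (intro exI[of _ ?e] exI[of _ ?f] exI[of _ k]) (auto simp: incident_def)
  qed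
  have three: "i = t \<or> i = s \<or> i = k"
    if "card S = 3" "R S e t" "R S f s" "R S (closing e f) k" "e \<noteq> f" "R S g i" for S e f g t s k i
    using that pairs_of_three(7)[of S e f g] birth_unique unfolding R_def by blast
  show ?thesis
  proof (rule bij_betw_imageI)
    show "inj_on ?tri (hits \<sigma>)"
    proof (rule inj_onI, clarify)
      fix t s t' s'
      assume h: "(t, s) \<in> hits \<sigma>" "(t', s') \<in> hits \<sigma>"
        and eq: "fst (\<sigma> ! t) \<union> fst (\<sigma> ! (Suc t + s)) = fst (\<sigma> ! t') \<union> fst (\<sigma> ! (Suc t' + s'))"
      define S where "S = ?tri (t, s)"
      from hit[OF h(1)] obtain e f k where
        *: "card S = 3" "R S e t" "R S f (Suc t + s)" "R S (closing e f) k" "e \<noteq> f" "Suc t + s < k"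
        unfolding S_def[symmetric] by blast
      have S': "?tri (t', s') = S" using eq by (simp add: S_def)
      from hit[OF h(2)] obtain e' f' k' where
        **: "R S e' t'" "R S f' (Suc t' + s')" "R S (closing e' f') k'" "Suc t' + s' < k'"
        unfolding S' by blast
      \<comment> \<open>Both triples of positions are increasing, and one lies in the set of the
        other, so they coincide.\<close>
      have "t' \<in> {t, Suc t + s, k}" "Suc t' + s' \<in> {t, Suc t + s, k}" "k' \<in> {t, Suc t + s, k}"
        using three[OF *(1-5)] ** by blast+
      with *(6) **(4) show "t = t' \<and> s = s'" by auto
    qed
    show "?tri ` hits \<sigma> = triangles F"
    proof (intro equalityI subsetI)
      fix S assume "S \<in> ?tri ` hits \<sigma>"
      then obtain t s where ts: "(t, s) \<in> hits \<sigma>" "S = ?tri (t, s)" by auto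
      from hit[OF ts(1)] obtain e f k where
        *: "card S = 3" "R S e t" "R S f (Suc t + s)" "R S (closing e f) k" "e \<noteq> f"
        unfolding ts(2)[symmetric] by blast
      have "S \<subseteq> {1..n}"
        using ts nth_edge[of t] nth_edge[of "Suc t + s"] by (auto simp: hits_iff complete_edges_def)
      moreover have "\<exists>i. birth \<sigma> g i" if "g \<subseteq> S" "card g = 2" for g
        using * pairs_of_three(7)[of S e f g] that unfolding R_def by blast
      ultimately show "S \<in> triangles F"
        using *(1) by (auto simp: triangles_def final_graph_iff complete_edges_def)
    next
      fix S assume "S \<in> triangles F"
      then have S: "card S = 3" and SF: "\<And>e. e \<subseteq> S \<Longrightarrow> card e = 2 \<Longrightarrow> e \<in> F"
        by (auto simp: triangles_def)
      have ex: "\<exists>i. R S e i" if "e \<subseteq> S" "card e = 2" for e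
        using SF[OF that] that by (auto simp: R_def final_graph_iff)
      obtain a b c where abc: "S = {a, b, c}" "a \<noteq> b" "a \<noteq> c" "b \<noteq> c"
        using S by (auto simp: card_3_iff)
      obtain i1 i2 i3 where i: "R S {a, b} i1" "R S {a, c} i2" "R S {b, c} i3"
        using ex[of "{a, b}"] ex[of "{a, c}"] ex[of "{b, c}"] abc by auto
      \<comment> \<open>An update concerns a single edge, so different sides have different
        births.\<close>
      have "i1 \<noteq> i2" "i1 \<noteq> i3" "i2 \<noteq> i3"
        using i abc birth_edge unfolding R_def by (metis doubleton_eq_iff)+
      then consider "i1 < i2 \<and> i2 < i3" | "i1 < i3 \<and> i3 < i2" | "i2 < i1 \<and> i1 < i3"
        | "i2 < i3 \<and> i3 < i1" | "i3 < i1 \<and> i1 < i2" | "i3 < i2 \<and> i2 < i1"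
        by linarith
      then have "\<exists>e f g t s k. R S e t \<and> R S f s \<and> R S g k \<and> t < s \<and> s < k"
        using i by cases blast+
      then obtain e f g t s k where
        *: "R S e t" "R S f s" "R S g k" "t < s" "s < k" by blast
      have neq: "e \<noteq> f" "g \<noteq> e" "g \<noteq> f"
        using * birth_unique unfolding R_def by (metis less_irrefl less_trans)+
      then have g: "g = closing e f" and Sef: "e \<union> f = S" and inc: "incident e f"
        using * S pairs_of_three[of S e f] unfolding R_def by blast+
      have idx: "fst (\<sigma> ! t) = e" "fst (\<sigma> ! s) = f" "s < length \<sigma>"
        using * birth_edge unfolding R_def by (auto simp: birth_def)
      have "(t, s - Suc t) \<in> hits \<sigma>"
        using * idx inc g unfolding hits_iff R_def by auto
      moreover have "S = ?tri (t, s - Suc t)" using * idx Sef by simp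
      ultimately show "S \<in> ?tri ` hits \<sigma>" by (rule rev_image_eqI)
    qed
  qed
qed

lemma card_hits: "card (hits \<sigma>) = num_triangles n \<sigma>"
  using bij_betw_same_card[OF bij_betw_hits_triangles] by (simp add: num_triangles_def)

section \<open>Counting incident updates; moments on a strict stream\<close>

lemma card_incidences_le:
  assumes "finite e"
  shows "card (incidences e (drop t \<sigma>)) \<le> (\<Sum>v\<in>e. card {i. i < length \<sigma> \<and> v \<in> fst (\<sigma> ! i)})"
proof -
  have "(\<lambda>s. t + s) ` incidences e (drop t \<sigma>) \<subseteq> (\<Union>v\<in>e. {i. i < length \<sigma> \<and> v \<in> fst (\<sigma> ! i)})"
    by (auto simp: incidences_def incident_def)
  then have "card ((\<lambda>s. t + s) ` incidences e (drop t \<sigma>))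
      \<le> card (\<Union>v\<in>e. {i. i < length \<sigma> \<and> v \<in> fst (\<sigma> ! i)})"
    using assms by (intro card_mono) auto
  also have "\<dots> \<le> (\<Sum>v\<in>e. card {i. i < length \<sigma> \<and> v \<in> fst (\<sigma> ! i)})"
    using assms by (rule card_UN_le)
  finally show ?thesis by (simp add: card_image)
qed

lemma sum_incidences_le:
  assumes d: "\<And>v. v \<in> {1..n} \<Longrightarrow> degree F v \<le> d"
  shows "(\<Sum>(t, s)\<in>hits \<sigma>. card (incidences (fst (\<sigma> ! t)) (drop (Suc t) \<sigma>))) \<le> 2 * length \<sigma> * d\<^sup>2"
proof -
  define r where "r v = card {i. i < length \<sigma> \<and> v \<in> fst (\<sigma> ! i)}" for v
  let ?tri = "\<lambda>(t, s). fst (\<sigma> ! t) \<union> fst (\<sigma> ! (Suc t + s))"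
  \<comment> \<open>Charging all three vertices of the triangle, not only those of the first edge,
    makes the bound a function of the triangle, and the bijection applies.\<close>
  have "(\<Sum>(t, s)\<in>hits \<sigma>. card (incidences (fst (\<sigma> ! t)) (drop (Suc t) \<sigma>)))
      \<le> (\<Sum>p\<in>hits \<sigma>. \<Sum>v\<in>?tri p. r v)"
  proof (intro sum_mono, clarify)
    fix t s assume "(t, s) \<in> hits \<sigma>"
    then have fin: "finite (fst (\<sigma> ! t))" "finite (fst (\<sigma> ! (Suc t + s)))"
      using nth_edge[of t] nth_edge[of "Suc t + s"]
      by (auto simp: hits_iff complete_edges_def intro: card_ge_0_finite)
    have "card (incidences (fst (\<sigma> ! t)) (drop (Suc t) \<sigma>)) \<le> (\<Sum>v\<in>fst (\<sigma> ! t). r v)"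
      unfolding r_def by (rule card_incidences_le[OF fin(1)])
    also have "\<dots> \<le> (\<Sum>v\<in>fst (\<sigma> ! t) \<union> fst (\<sigma> ! (Suc t + s)). r v)"
      using fin by (intro sum_mono2) auto
    finally show "card (incidences (fst (\<sigma> ! t)) (drop (Suc t) \<sigma>))
        \<le> (\<Sum>v\<in>fst (\<sigma> ! t) \<union> fst (\<sigma> ! (Suc t + s)). r v)" .
  qed
  also have "\<dots> = (\<Sum>S\<in>triangles F. \<Sum>v\<in>S. r v)"
    by (rule sum.reindex_bij_betw[OF bij_betw_hits_triangles])
  also have "\<dots> = (\<Sum>S\<in>triangles F. \<Sum>v\<in>{v \<in> {1..n}. v \<in> S}. r v)"
    by (intro sum.cong refl) (use triangle_subset in blast)
  also have "\<dots> = (\<Sum>v\<in>{1..n}. \<Sum>S\<in>{S \<in> triangles F. v \<in> S}. r v)"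
    by (rule sum.swap_restrict) auto
  also have "\<dots> = (\<Sum>v\<in>{1..n}. r v * card {S \<in> triangles F. v \<in> S})"
    by (simp add: mult.commute)
  also have "\<dots> \<le> (\<Sum>v\<in>{1..n}. r v * d\<^sup>2)"
    using d by (intro sum_mono mult_left_mono order_trans[OF card_triangles_at] power_mono) auto
  also have "\<dots> = (\<Sum>v\<in>{1..n}. r v) * d\<^sup>2"
    by (simp add: sum_distrib_right)
  \<comment> \<open>Double counting: summed by updates instead of vertices, each update contributes
    its two endpoints.\<close>
  also have "(\<Sum>v\<in>{1..n}. r v) = (\<Sum>v\<in>{1..n}. \<Sum>i\<in>{i \<in> {..<length \<sigma>}. v \<in> fst (\<sigma> ! i)}. 1)"
    by (simp add: r_def)
  also have "\<dots> = (\<Sum>i<length \<sigma>. \<Sum>v\<in>{v \<in> {1..n}. v \<in> fst (\<sigma> ! i)}. 1)"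
    by (rule sum.swap_restrict) auto
  also have "\<dots> = (\<Sum>i<length \<sigma>. 2)"
  proof (rule sum.cong)
    fix i assume "i \<in> {..<length \<sigma>}"
    then have "{v \<in> {1..n}. v \<in> fst (\<sigma> ! i)} = fst (\<sigma> ! i)" "card (fst (\<sigma> ! i)) = 2"
      using nth_edge[of i] by (auto simp: complete_edges_def)
    then show "(\<Sum>v\<in>{v \<in> {1..n}. v \<in> fst (\<sigma> ! i)}. 1) = (2::nat)" by simp
  qed simp
  finally show ?thesis by simp
qed

text \<open>The bound by \<open>length \<sigma>\<close> controls the rounding of the number of
  samplers on short streams; the bound by \<open>n\<close> pays for exact storage on long
  ones.\<close>

lemma num_triangles_le:
  assumes "\<And>v. v \<in> {1..n} \<Longrightarrow> degree F v \<le> d"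
  shows "num_triangles n \<sigma> \<le> 2 * d * length \<sigma>" "num_triangles n \<sigma> \<le> 2 * d * n\<^sup>2"
proof -
  have *: "num_triangles n \<sigma> \<le> 2 * d * card F"
    unfolding num_triangles_def using assms
    by (intro card_triangles_le) (auto simp: final_graph_def complete_edges_def)
  then show "num_triangles n \<sigma> \<le> 2 * d * length \<sigma>"
    using card_final_graph by (meson mult_le_mono2 order_trans)
  have "card F \<le> card (complete_edges n)" by (intro card_mono) (auto simp: final_graph_def)
  with card_complete_edges[of n] have "card F \<le> n\<^sup>2" by simp
  with * show "num_triangles n \<sigma> \<le> 2 * d * n\<^sup>2" by (meson mult_le_mono2 order_trans)
qed

lemma sampler_expectation:
  assumes "\<sigma> \<noteq> []"
  shows "measure_pmf.expectation (process sampler_step (sampler_init (length \<sigma>)) \<sigma>)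
      (sampler_value (length \<sigma>)) = real (num_triangles n \<sigma>)"
  using sampler_moment[OF refl, of \<sigma> 0] assms by (simp add: card_hits case_prod_unfold)

lemma sampler_second_moment:
  assumes "\<sigma> \<noteq> []" and d: "\<And>v. v \<in> {1..n} \<Longrightarrow> degree F v \<le> d"
  shows "measure_pmf.expectation (process sampler_step (sampler_init (length \<sigma>)) \<sigma>)
      (\<lambda>x. (sampler_value (length \<sigma>) x)\<^sup>2) \<le> 2 * (real (length \<sigma>))\<^sup>2 * (real d)\<^sup>2"
proof -
  let ?r = "\<lambda>t. card (incidences (fst (\<sigma> ! t)) (drop (Suc t) \<sigma>))"
  have "measure_pmf.expectation (process sampler_step (sampler_init (length \<sigma>)) \<sigma>)
      (\<lambda>x. (sampler_value (length \<sigma>) x)\<^sup>2) = real (length \<sigma>) * real (\<Sum>(t, s)\<in>hits \<sigma>. ?r t)"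
    using sampler_moment[OF refl, of \<sigma> 1] assms(1)
    by (simp add: case_prod_unfold sum_distrib_left numeral_2_eq_2)
  also have "\<dots> \<le> real (length \<sigma>) * real (2 * length \<sigma> * d\<^sup>2)"
    using sum_incidences_le[OF d] by (intro mult_left_mono) (simp_all only: of_nat_le_iff of_nat_0_le_iff)
  finally show ?thesis by (simp add: power2_eq_square mult_ac)
qed

end

section \<open>The streaming algorithm\<close>

lemma valid_stream_strict: "valid_stream c n d L \<sigma> \<Longrightarrow> strict_stream n \<sigma>"
  by unfold_locales (auto simp: valid_stream_def)

lemma freq_not_updated: "e \<notin> fst ` set \<sigma> \<Longrightarrow> freq \<sigma> e = 0"
  by (induction \<sigma> rule: rev_induct) (auto simp: freq_snoc)

text \<open>For parameters without an admissible stream; the space bound may then be 0, for instance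
  if \<open>d = 0\<close>.\<close>

lemma ex_trivial_algorithm: "\<exists>A. uses_space A n 0"
proof -
  have "finite {()}" "card {()} \<le> 2 ^ 0" by simp_all
  from ex_bit_algorithm[OF this, of n "\<lambda>_ _. return_pmf ()" "return_pmf ()" "\<lambda>_. 0"]
  show ?thesis by auto
qed

text \<open>The state is the whole multiplicity vector, with at most \<open>n ^ c + 1\<close> values
  per edge on valid streams. The output is then exact.\<close>

lemma ex_exact_algorithm:
  assumes m: "(n ^ c + 1) ^ card (complete_edges n) \<le> 2 ^ m" and \<epsilon>: "\<epsilon> > 0"
  shows "\<exists>A. uses_space A n (real m) \<and> counts_triangles A c n d L T \<epsilon>"
proof -
  define stp :: "update \<Rightarrow> (nat set \<Rightarrow> int) \<Rightarrow> (nat set \<Rightarrow> int) pmf"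
    where "stp u f = return_pmf (f(fst u := f (fst u) + snd u))" for u f
  define est where "est f = real (card (triangles {e \<in> complete_edges n. f e = 1}))" for f :: "nat set \<Rightarrow> int"
  define S where "S = PiE_dflt (complete_edges n) 0 (\<lambda>_. {0..int (n ^ c)})"
  have "finite S" unfolding S_def by auto
  moreover have "card S \<le> 2 ^ m"
    unfolding S_def using m by (subst card_PiE_dflt) (auto simp: nat_add_distrib simp del: of_nat_power)
  ultimately obtain A where A: "uses_space A n (real m)"
    "\<And>\<sigma>. (\<And>i. set_pmf (process stp (return_pmf (\<lambda>_. 0)) (take i \<sigma>)) \<subseteq> S) \<Longrightarrow>
       result A \<sigma> = map_pmf est (process stp (return_pmf (\<lambda>_. 0)) \<sigma>)"
    using ex_bit_algorithm[of S m n stp "return_pmf (\<lambda>_. 0)" est] by blast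
  have process: "process stp (return_pmf (\<lambda>_. 0)) \<sigma> = return_pmf (freq \<sigma>)" for \<sigma>
    by (induction \<sigma> rule: rev_induct) (auto simp: bind_return_pmf stp_def freq_snoc fun_eq_iff)
  have "measure_pmf.prob (result A \<sigma>)
      {(1 - \<epsilon>) * real (num_triangles n \<sigma>) .. (1 + \<epsilon>) * real (num_triangles n \<sigma>)} \<ge> 2 / 3"
    if valid: "valid_stream c n d L \<sigma>" for \<sigma>
  proof -
    have "freq (take i \<sigma>) \<in> S" for i
    proof -
      have edges: "fst ` set (take i \<sigma>) \<subseteq> complete_edges n"
        using valid by (auto simp: valid_stream_def dest!: in_set_takeD)
      \<comment> \<open>Prefix lengths beyond \<open>L\<close> are cut to \<open>L\<close>, the
        range in which validity bounds the multiplicities.\<close>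
      have take: "take (min i L) \<sigma> = take i \<sigma>"
        using valid by (auto simp: valid_stream_def min_def)
      have "0 \<le> freq (take i \<sigma>) e \<and> freq (take i \<sigma>) e \<le> int (n ^ c)" if "e \<in> complete_edges n" for e
        using valid that unfolding take[symmetric] by (simp add: valid_stream_def)
      then show ?thesis
        using edges by (auto simp: S_def PiE_dflt_def intro!: freq_not_updated)
    qed
    then have "result A \<sigma> = return_pmf (est (freq \<sigma>))"
      by (subst A(2)) (simp_all add: process)
    moreover have "est (freq \<sigma>) = real (num_triangles n \<sigma>)"
      by (simp add: est_def num_triangles_def final_graph_def)
    ultimately show ?thesis using \<epsilon> by (simp add: algebra_simps)
  qed
  with A(1) show ?thesis unfolding counts_triangles_def by blast
qed

text \<open>If N is the number of triangles, the average of \<open>k\<close> samplers deviates by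
  more than \<epsilon> N with probability at most 2 L^2 d^2 / (k \<epsilon>^2 N^2). The hypothesis
  on \<open>k\<close> makes this at most 1/3, because N is at least \<open>T\<close>.\<close>

lemma ex_sampling_algorithm:
  assumes m: "card (sampler_states (complete_edges n) L (n ^ c) L) ^ k \<le> 2 ^ m"
    and pos: "k > 0" "L > 0" "\<epsilon> > 0" "T > 0"
    and k: "6 * (real L)\<^sup>2 * (real d)\<^sup>2 \<le> real k * (\<epsilon>\<^sup>2 * (real T)\<^sup>2)"
  shows "\<exists>A. uses_space A n (real m) \<and> counts_triangles A c n d L T \<epsilon>"
proof -
  let ?S1 = "sampler_states (complete_edges n) L (n ^ c) L"
  \<comment> \<open>A filler outside \<open>{..<k}\<close>; fixing the value there makes the set of
    joint states finite.\<close>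
  define x0 where "x0 = Wait 0"
  define p where "p = Pi_pmf {..<k} x0 (\<lambda>_. sampler_init L)"
  define stp where "stp u f = Pi_pmf {..<k} x0 (\<lambda>i. sampler_step u (f i))" for u f
  define est where "est f = (\<Sum>i<k. sampler_value L (f i)) / real k" for f :: "nat \<Rightarrow> sampler"
  define S where "S = PiE_dflt {..<k} x0 (\<lambda>_. ?S1)"
  have "finite S" unfolding S_def by (intro finite_PiE_dflt finite_sampler_states) auto
  moreover have "card S \<le> 2 ^ m"
    unfolding S_def using m by (subst card_PiE_dflt) (simp_all add: finite_sampler_states)
  ultimately obtain A where A: "uses_space A n (real m)"
    "\<And>\<sigma>. (\<And>i. set_pmf (process stp p (take i \<sigma>)) \<subseteq> S) \<Longrightarrow> result A \<sigma> = map_pmf est (process stp p \<sigma>)"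
    using ex_bit_algorithm[of S m n stp p est] by blast
  have process: "process stp p \<sigma> = Pi_pmf {..<k} x0 (\<lambda>_. process sampler_step (sampler_init L) \<sigma>)" for \<sigma>
    unfolding stp_def p_def by (rule process_Pi_pmf) simp
  have "measure_pmf.prob (result A \<sigma>)
      {(1 - \<epsilon>) * real (num_triangles n \<sigma>) .. (1 + \<epsilon>) * real (num_triangles n \<sigma>)} \<ge> 2 / 3"
    if valid: "valid_stream c n d L \<sigma>" and T: "T \<le> num_triangles n \<sigma>" for \<sigma>
  proof -
    interpret strict_stream n \<sigma> using valid by (rule valid_stream_strict)
    have L: "length \<sigma> = L" and d: "\<And>v. v \<in> {1..n} \<Longrightarrow> degree F v \<le> d"
      using valid by (auto simp: valid_stream_def)
    have ne: "\<sigma> \<noteq> []" using L pos by auto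
    let ?N = "real (num_triangles n \<sigma>)"
    have N: "?N \<ge> real T" "?N > 0" using T pos by auto
    have "set_pmf (process stp p (take i \<sigma>)) \<subseteq> S" for i
    proof -
      have "set_pmf (process sampler_step (sampler_init L) (take i \<sigma>)) \<subseteq> ?S1"
        using valid L pos
        by (intro set_process_sampler) (auto simp: valid_stream_def dest!: in_set_takeD)
      then show ?thesis
        unfolding process S_def by (auto simp: set_Pi_pmf PiE_dflt_def)
    qed
    then have "result A \<sigma> = map_pmf est (Pi_pmf {..<k} x0 (\<lambda>_. process sampler_step (sampler_init L) \<sigma>))"
      by (simp add: A(2) process)
    then have result: "result A \<sigma> = map_pmf (\<lambda>f. (\<Sum>i<k. sampler_value L (f i)) / real k)
        (Pi_pmf {..<k} x0 (\<lambda>_. process sampler_step (sampler_init L) \<sigma>))"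
      by (simp add: est_def[abs_def])
    have "1 - 2 * (real L)\<^sup>2 * (real d)\<^sup>2 / (real k * (\<epsilon> * ?N)\<^sup>2)
        \<le> measure_pmf.prob (result A \<sigma>) {?N - \<epsilon> * ?N .. ?N + \<epsilon> * ?N}"
      unfolding result using sampler_expectation[OF ne] sampler_second_moment[OF ne d] L pos N
      by (intro Pi_pmf_average_concentration finite_set_process_sampler) auto
    moreover have "2 * (real L)\<^sup>2 * (real d)\<^sup>2 / (real k * (\<epsilon> * ?N)\<^sup>2) \<le> 1 / 3"
    proof -
      have "real k * (\<epsilon>\<^sup>2 * (real T)\<^sup>2) \<le> real k * (\<epsilon> * ?N)\<^sup>2"
        using N by (auto simp: power_mult_distrib intro!: mult_left_mono power_mono)
      with k have "6 * (real L)\<^sup>2 * (real d)\<^sup>2 \<le> real k * (\<epsilon> * ?N)\<^sup>2" by (rule order_trans)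
      moreover have "real k * (\<epsilon> * ?N)\<^sup>2 > 0" using pos N by simp
      ultimately show ?thesis by (subst divide_le_eq) simp
    qed
    moreover have "{?N - \<epsilon> * ?N .. ?N + \<epsilon> * ?N} = {(1 - \<epsilon>) * ?N .. (1 + \<epsilon>) * ?N}"
      by (simp add: algebra_simps)
    ultimately show ?thesis by simp
  qed
  with A(1) show ?thesis unfolding counts_triangles_def by blast
qed

section \<open>Bit counts and the choice of parameters\<close>

text \<open>A further summand costs one more power of \<open>n\<close>, because 2 is at most
  \<open>n\<close>.\<close>

lemma Suc_le_power_Suc:
  fixes n x a :: nat
  assumes "2 \<le> n" "x \<le> n ^ a" "y \<le> n ^ a"
  shows "x + y \<le> n ^ Suc a"
proof -
  have "x + y \<le> 2 * n ^ a" using assms by simp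
  also have "\<dots> \<le> n * n ^ a" using assms by (intro mult_right_mono) auto
  finally show ?thesis by simp
qed

text \<open>The exponents add up: 2 for each of two edges, c + 3 for each of three counters and 3
  for \<open>r\<close> give 3 c + 16. The empty reservoir and the waiting states cost one more
  each.\<close>

lemma card_sampler_states_le_power:
  assumes n: "2 \<le> n" and L: "L < n ^ 3"
  shows "card (sampler_states (complete_edges n) L (n ^ c) L) \<le> n ^ (3 * c + 18)"
proof -
  let ?E = "card (complete_edges n)" and ?a = "L * n ^ c + 1"
  have one: "1 \<le> n ^ i" for i using n by simp
  have E: "?E \<le> n ^ 2" by (rule card_complete_edges)
  have "?a \<le> (L + 1) * n ^ c" using one[of c] by simp
  also have "\<dots> \<le> n ^ 3 * n ^ c" using L by (intro mult_right_mono) auto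
  finally have a: "?a \<le> n ^ (c + 3)" by (simp add: power_add mult.commute)
  have "?E * ?a\<^sup>2 \<le> n ^ 2 * (n ^ (c + 3))\<^sup>2"
    by (intro mult_mono E power_mono a) auto
  also have "\<dots> = n ^ (2 * c + 8)"
    by (simp only: power_mult[symmetric] power_add[symmetric]) (rule arg_cong[of _ _ "(^) n"], simp)
  finally have "1 + ?E * ?a\<^sup>2 \<le> n ^ Suc (2 * c + 8)"
    using n one by (intro Suc_le_power_Suc)
  then have "?E * (?a * ((L + 1) * (1 + ?E * ?a\<^sup>2))) \<le> n ^ 2 * (n ^ (c + 3) * (n ^ 3 * n ^ Suc (2 * c + 8)))"
    using L by (intro mult_mono E a) auto
  also have "\<dots> = n ^ (3 * c + 17)"
    by (simp only: power_add[symmetric]) (rule arg_cong[of _ _ "(^) n"], simp)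
  finally have "L + ?E * (?a * ((L + 1) * (1 + ?E * ?a\<^sup>2))) \<le> n ^ Suc (3 * c + 17)"
  proof (intro Suc_le_power_Suc n)
    have "n ^ 3 \<le> n ^ (3 * c + 17)" using n by (intro power_increasing) auto
    then show "L \<le> n ^ (3 * c + 17)" using L by simp
  qed
  then have "card (sampler_states (complete_edges n) L (n ^ c) L) \<le> n ^ Suc (3 * c + 17)"
    by (rule order_trans[OF card_sampler_states[OF finite_complete_edges]])
  moreover have "Suc (3 * c + 17) = 3 * c + 18" by simp
  ultimately show ?thesis by (simp only:)
qed

text \<open>Rounding up adds at most 1, which is at most \<open>log 2 (real n)\<close> since
  \<open>n\<close> is at least 2.\<close>

lemma ex_bits:
  assumes "2 \<le> n"
  obtains b where "n \<le> 2 ^ b" "real b \<le> 2 * log 2 (real n)"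
proof -
  define b where "b = nat \<lceil>log 2 (real n)\<rceil>"
  have log: "1 \<le> log 2 (real n)" using assms by (simp add: le_log_iff)
  then have b: "log 2 (real n) \<le> real b" "real b \<le> log 2 (real n) + 1" unfolding b_def by linarith+
  have "real n = 2 powr (log 2 (real n))" using assms by simp
  also have "\<dots> \<le> 2 powr (real b)" using b by (intro powr_mono) auto
  finally have "real n \<le> real (2 ^ b)" by (simp add: powr_realpow)
  then have "n \<le> 2 ^ b" by (simp only: of_nat_le_iff)
  with b log that show thesis by auto
qed

theorem theorem11:
  fixes c :: nat
  shows "\<exists>C > 0. \<forall>(n::nat) (d::nat) (L::nat) (T::nat) (\<epsilon>::real).
    1 \<le> T \<longrightarrow> 0 < \<epsilon> \<longrightarrow> \<epsilon> < 1 \<longrightarrow>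
    (\<exists>A. uses_space A n
            (C * (real d ^ 3 * real L ^ 2 / (\<epsilon> ^ 2 * real T ^ 2)) * log 2 (real n)) \<and>
         counts_triangles A c n d L T \<epsilon>)"
proof -
  define B where "B = 3 * c + 18"
  have main: "\<exists>A. uses_space A n
            (20 * real B * (real d ^ 3 * real L ^ 2 / (\<epsilon> ^ 2 * real T ^ 2)) * log 2 (real n)) \<and>
         counts_triangles A c n d L T \<epsilon>"
    if T: "1 \<le> T" and \<epsilon>: "0 < \<epsilon>" "\<epsilon> < 1" for n d L T :: nat and \<epsilon> :: real
  proof (cases "\<exists>\<sigma>. valid_stream c n d L \<sigma> \<and> T \<le> num_triangles n \<sigma>")
    case False
    obtain A where A: "uses_space A n 0" using ex_trivial_algorithm by blast
    \<comment> \<open>For \<open>n = 0\<close> the logarithm has the default value 0.\<close>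
    have "0 \<le> log 2 (real n)" by (cases "n = 0") (auto simp: log_def)
    then have "uses_space A n
        (20 * real B * (real d ^ 3 * real L ^ 2 / (\<epsilon> ^ 2 * real T ^ 2)) * log 2 (real n))"
      by (intro uses_space_mono[OF A] mult_nonneg_nonneg divide_nonneg_nonneg) auto
    moreover have "counts_triangles A c n d L T \<epsilon>" using False by (auto simp: counts_triangles_def)
    ultimately show ?thesis by blast
  next
    case True
    \<comment> \<open>A single admissible stream already yields the relations between
      \<open>T\<close>, \<open>d\<close>, \<open>L\<close> and \<open>n\<close> on which the space
      bound rests.\<close>
    then obtain \<sigma> where \<sigma>: "valid_stream c n d L \<sigma>" "T \<le> num_triangles n \<sigma>" by blast
    interpret strict_stream n \<sigma> using \<sigma>(1) by (rule valid_stream_strict)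
    have "length \<sigma> = L" and deg: "\<And>v. v \<in> {1..n} \<Longrightarrow> degree F v \<le> d"
      using \<sigma>(1) by (auto simp: valid_stream_def)
    then have TdL: "T \<le> 2 * d * L" and Tdn: "T \<le> 2 * d * n\<^sup>2"
      using num_triangles_le[OF deg] \<sigma>(2) by auto
    then have d: "1 \<le> d" and L: "1 \<le> L" using T by (auto simp: Suc_le_eq intro: Nat.gr0I)
    have n: "2 \<le> n"
    proof -
      have "fst (\<sigma> ! 0) \<subseteq> {1..n}" "card (fst (\<sigma> ! 0)) = 2"
        using nth_edge[of 0] L \<open>length \<sigma> = L\<close> by (auto simp: complete_edges_def)
      then show ?thesis using card_mono[of "{1..n}" "fst (\<sigma> ! 0)"] by simp
    qed
    obtain b where b: "n \<le> 2 ^ b" "real b \<le> 2 * log 2 (real n)" using ex_bits[OF n] by blast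
    have log: "0 \<le> log 2 (real n)" using n by simp
    have eT: "\<epsilon>\<^sup>2 * (real T)\<^sup>2 > 0" using T \<epsilon> by simp
    have eT_le: "\<epsilon>\<^sup>2 * (real T)\<^sup>2 \<le> (real T)\<^sup>2"
      using \<epsilon> by (intro mult_left_le_one_le) (auto simp: power_le_one)
    define \<rho> where "\<rho> = real d ^ 3 * real L ^ 2 / (\<epsilon> ^ 2 * real T ^ 2)"
    have \<rho>: "0 \<le> \<rho>" by (simp add: \<rho>_def)
    \<comment> \<open>Space is counted in words of \<open>b\<close> bits; \<open>b\<close> is at
      most twice the logarithm, which turns 10 into 20.\<close>
    have enough: "\<exists>A. uses_space A n (20 * real B * \<rho> * log 2 (real n)) \<and> counts_triangles A c n d L T \<epsilon>"
      if alg: "\<exists>A. uses_space A n (real (w * b)) \<and> counts_triangles A c n d L T \<epsilon>"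
        and w: "real w \<le> 10 * real B * \<rho>" for w
    proof -
      have "real (w * b) \<le> 10 * real B * \<rho> * (2 * log 2 (real n))"
        unfolding of_nat_mult using w b log \<rho> by (intro mult_mono) auto
      then have "real (w * b) \<le> 20 * real B * \<rho> * log 2 (real n)" by simp
      with alg show ?thesis by (meson uses_space_mono)
    qed
    have "\<exists>A. uses_space A n (20 * real B * \<rho> * log 2 (real n)) \<and> counts_triangles A c n d L T \<epsilon>"
    proof (cases "L < n ^ 3")
      case True
      define \<rho>' where "\<rho>' = (real L)\<^sup>2 * (real d)\<^sup>2 / (\<epsilon>\<^sup>2 * (real T)\<^sup>2)"
      define k where "k = nat \<lceil>6 * \<rho>'\<rceil>"
      have "real T \<le> real (2 * d * L)" using TdL by (simp only: of_nat_le_iff)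
      then have "(real T)\<^sup>2 \<le> (2 * real d * real L)\<^sup>2" by (intro power_mono) simp_all
      with eT_le have "\<epsilon>\<^sup>2 * (real T)\<^sup>2 \<le> 4 * ((real L)\<^sup>2 * (real d)\<^sup>2)"
        by (simp add: power_mult_distrib mult_ac)
      \<comment> \<open>This lower bound absorbs the rounding in \<open>k\<close>: 6 \<rho>' + 1 is
        at most 10 \<rho>'.\<close>
      then have \<rho>'4: "1 \<le> 4 * \<rho>'" using eT by (simp add: \<rho>'_def le_divide_eq)
      have k: "6 * \<rho>' \<le> real k" "real k \<le> 6 * \<rho>' + 1" unfolding k_def using \<rho>'4 by linarith+
      have "\<rho>' \<le> real d * \<rho>'" using d \<rho>'4 by simp
      also have "real d * \<rho>' = \<rho>" by (simp add: \<rho>_def \<rho>'_def power2_eq_square power3_eq_cube)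
      finally have k\<rho>: "real k \<le> 10 * \<rho>" using k \<rho>'4 by linarith
      have "card (sampler_states (complete_edges n) L (n ^ c) L) ^ k \<le> (n ^ B) ^ k"
        unfolding B_def by (intro power_mono card_sampler_states_le_power n True) simp
      also have "\<dots> \<le> ((2 ^ b) ^ B) ^ k" by (intro power_mono b) auto
      also have "\<dots> = 2 ^ (k * B * b)" by (simp add: mult_ac flip: power_mult)
      finally have "\<exists>A. uses_space A n (real (k * B * b)) \<and> counts_triangles A c n d L T \<epsilon>"
      proof (rule ex_sampling_algorithm)
        show "6 * (real L)\<^sup>2 * (real d)\<^sup>2 \<le> real k * (\<epsilon>\<^sup>2 * (real T)\<^sup>2)"
          using k(1) eT by (simp add: \<rho>'_def divide_le_eq)
        show "k > 0" using k \<rho>'4 by (intro Nat.gr0I) auto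
      qed (use L \<epsilon> T in auto)
      moreover have "real (k * B) \<le> 10 * real B * \<rho>"
        using mult_right_mono[OF k\<rho>, of "real B"] by (simp add: mult_ac)
      ultimately show ?thesis by (rule enough)
    next
      case False
      have "(n ^ c + 1) ^ card (complete_edges n) \<le> (n ^ Suc c) ^ (n ^ 2)"
        using n by (intro order_trans[OF power_mono power_increasing] Suc_le_power_Suc
            card_complete_edges) auto
      also have "\<dots> \<le> ((2 ^ b) ^ Suc c) ^ (n ^ 2)" by (intro power_mono b) auto
      also have "\<dots> = 2 ^ (n\<^sup>2 * Suc c * b)" by (simp only: mult_ac flip: power_mult)
      finally have "\<exists>A. uses_space A n (real (n\<^sup>2 * Suc c * b)) \<and> counts_triangles A c n d L T \<epsilon>"
        using \<epsilon>(1) by (rule ex_exact_algorithm)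
      moreover have "real (n\<^sup>2 * Suc c) \<le> 10 * real B * \<rho>"
      proof -
        \<comment> \<open>From T <= 2 d n^2 and n^3 <= L follows n^2 \<epsilon>^2 T^2 <= 4 d^2 n^6
          <= 4 d^3 L^2, that is, n^2 <= 4 \<rho>.\<close>
        have "real T \<le> real (2 * d * n\<^sup>2)" using Tdn by (simp only: of_nat_le_iff)
        then have "(real T)\<^sup>2 \<le> (2 * real d * (real n)\<^sup>2)\<^sup>2" by (intro power_mono) simp_all
        with eT_le have "\<epsilon>\<^sup>2 * (real T)\<^sup>2 \<le> (2 * real d * (real n)\<^sup>2)\<^sup>2" by (rule order_trans)
        then have "(real n)\<^sup>2 * (\<epsilon>\<^sup>2 * (real T)\<^sup>2) \<le> (real n)\<^sup>2 * (2 * real d * (real n)\<^sup>2)\<^sup>2"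
          by (rule mult_left_mono) simp
        also have "\<dots> = 4 * (real d)\<^sup>2 * ((real n) ^ 3)\<^sup>2"
          by (simp add: power2_eq_square power3_eq_cube)
        also have "\<dots> \<le> 4 * (real d) ^ 3 * (real L)\<^sup>2"
        proof (intro mult_mono power_mono)
          show "(real d)\<^sup>2 \<le> (real d) ^ 3" using d by (intro power_increasing) auto
          have "real (n ^ 3) \<le> real L" using False by (simp only: of_nat_le_iff not_less)
          then show "(real n) ^ 3 \<le> real L" by simp
        qed auto
        finally have "(real n)\<^sup>2 \<le> 4 * \<rho>" using eT by (simp add: \<rho>_def le_divide_eq)
        then have "real (n\<^sup>2 * Suc c) \<le> 4 * \<rho> * real (Suc c)"
          unfolding of_nat_mult of_nat_power by (intro mult_right_mono) auto
        also have "\<dots> \<le> 4 * \<rho> * real B"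
          using \<rho> unfolding B_def by (intro mult_left_mono) auto
        also have "\<dots> \<le> 10 * \<rho> * real B"
          using \<rho> by (intro mult_right_mono) auto
        finally show ?thesis by (simp add: mult_ac)
      qed
      ultimately show ?thesis by (rule enough)
    qed
    then show ?thesis by (simp add: \<rho>_def)
  qed
  have "20 * real B > 0" by (simp add: B_def)
  with main show ?thesis by blast
qed

end
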